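(* Let $\mathcal{O}$ be a set of $\Omega_N^{\mathbb{R},+}\times\mathcal{B}^{\mathbb{C}}$. Then the number of eigenvalues of each $(\boldsymbol\omega,\mathbf{A})\in\mathcal{O}$ is equal (i.e. all problems in $\mathcal{O}$ have the same number of eigenvalues) if and only if each eigenvalue function $\lambda_n(\boldsymbol\omega,\mathbf{A})$ restricted in $\mathcal{O}$ is continuous. Furthermore, if $\mathcal{O}$ is a connected set of $\Omega_N^{\mathbb{R},+}\times\mathcal{B}^{\mathbb{C}}$, then each eigenvalue function $\lambda_n(\boldsymbol\omega,\mathbf{A})$ is locally a continuous eigenvalue branch in $\mathcal{O}$.
   Context: Fix an integer $N\ge 2$. A self-adjoint discrete Sturm–Liouville problem (SLP) is a pair $(\boldsymbol\omega,\mathbf{A})$. Here $\boldsymbol\omega=(1/f,q,w)$ with real sequences $f=\{f_n\}_{n=0}^N$, $q=\{q_n\}_{n=1}^N$, $w=\{w_n\}_{n=1}^N$, $f_n\ne0$, $w_n>0$, encodes the equation $-\nabla(f_n\Delta y_n)+q_ny_n=\lambda w_ny_n$, $1\le n\le N$, for $y=(y_0,\dots,y_{N+1})$, with $\Delta y_n=y_{n+1}-y_n$, $\nabla y_n=y_n-y_{n-1}$; the set $\Omega_N^{\mathbb{R},+}$ of all such $(1/f,q,w)$ has the topology of a subset of $\mathbb{R}^{3N+1}$. $\mathbf{A}=[A\,|\,B]$ encodes the boundary condition $A\begin{pmatrix}y_0\\ f_0\Delta y_0\end{pmatrix}+B\begin{pmatrix}y_N\\ f_N\Delta y_N\end{pmatrix}=0$,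 where $A,B$ are complex $2\times2$ matrices with $\mathrm{rank}(A,B)=2$ and $AJA^*=BJB^*$, $J=\begin{pmatrix}0&1\\-1&0\end{pmatrix}$; $[A\,|\,B]$ is the class of the $2\times4$ matrix $(A,B)$ modulo left multiplication by $GL(2,\mathbb{C})$, and $\mathcal{B}^{\mathbb{C}}$ is the set of all such classes, topologized as a subspace of the quotient of the rank-2 complex $2\times 4$ matrices by $GL(2,\mathbb{C})$. $\Omega_N^{\mathbb{R},+}\times\mathcal{B}^{\mathbb{C}}$ has the product topology. An eigenvalue of $(\boldsymbol\omega,\mathbf{A})$ is a $\lambda$ for which a nonzero $y$ solves the equation and the boundary condition. Eigenvalues are real and finite in number; they are counted with multiplicity (the dimension of the solution space) and listed as $\lambda_0(\boldsymbol\omega,\mathbf{A})\le\lambda_1(\boldsymbol\omega,\mathbf{A})\le\cdots$; $\lambda_n(\boldsymbol\omega,\mathbf{A})$ is defined only if there are more than $n$ eigenvalues. The eigenvalue functions considered on $\mathcal{O}$ are those $\lambda_n$ that are defined at at least one point of $\mathcal{O}$; "$\lambda_n$ restricted in $\mathcal{O}$ is continuous" means that $\lambda_n$ is defined at every point of $\mathcal{O}$ and is continuous in the relative topology of $\mathcal{O}$. A continuous eigenvalue branch is a continuous real function $\Lambda$ on a connected set $\mathcal{F}$ of SLPs such that $\Lambda(\boldsymbol\omega,\mathbf{A})$ is an eigenvalue of $(\boldsymbol\omega,\mathbf{A})$ for each $(\boldsymbol\omega,\mathbf{A})\in\mathcal{F}$. A function on $\mathcal{O}$ is locally a continuous eigenvalue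 branch in $\mathcal{O}$ if every point of $\mathcal{O}$ has a connected neighborhood in $\mathcal{O}$ on which the function is a continuous eigenvalue branch.
   Formalization: In the "Furthermore" sentence, the formal theorem assumes, besides connectedness of O, that all problems in O have the same number of eigenvalues; with connectedness alone the sentence fails, since some λ_n may be undefined at points of O. *)

theory Defs
  imports "HOL-Analysis.Analysis" "HOL-Library.Function_Algebras" "HOL-Library.Multiset"
begin

text \<open>Equations. The triple \<open>\<omega> = (1/f, q, w)\<close> is stored with \<open>1/f\<close> (not \<open>f\<close>) as its first
  component. Sequences with a finite index set are extensional functions on that set, so that
  \<open>powertop_real\<close> of the index set is the usual topology of the corresponding power of the
  real line.\<close>

type_synonym sl_equation = "(nat \<Rightarrow> real) \<times> (nat \<Rightarrow> real) \<times> (nat \<Rightarrow> real)"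

definition coeff_f :: "sl_equation \<Rightarrow> nat \<Rightarrow> real"
  where "coeff_f \<omega> n = 1 / fst \<omega> n"

definition coeff_q :: "sl_equation \<Rightarrow> nat \<Rightarrow> real"
  where "coeff_q \<omega> = fst (snd \<omega>)"

definition coeff_w :: "sl_equation \<Rightarrow> nat \<Rightarrow> real"
  where "coeff_w \<omega> = snd (snd \<omega>)"

definition Omega :: "nat \<Rightarrow> sl_equation set"
  where "Omega N = ({0..N} \<rightarrow>\<^sub>E {r. r \<noteq> 0}) \<times> ({1..N} \<rightarrow>\<^sub>E UNIV) \<times> ({1..N} \<rightarrow>\<^sub>E {0<..})"

definition Omega_top :: "nat \<Rightarrow> sl_equation topology"
  where "Omega_top N = subtopology
    (prod_topology (powertop_real {0..N}) (prod_topology (powertop_real {1..N}) (powertop_real {1..N})))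
    (Omega N)"

text \<open>Boundary conditions. The pair \<open>(A, B)\<close> is a \<open>2 \<times> 4\<close> matrix, \<open>A\<close> being its first two
  columns and \<open>B\<close> its last two.\<close>

definition left_block :: "complex^4^2 \<Rightarrow> complex^2^2"
  where "left_block M = (\<chi> i. vector [M $ i $ 1, M $ i $ 2])"

definition right_block :: "complex^4^2 \<Rightarrow> complex^2^2"
  where "right_block M = (\<chi> i. vector [M $ i $ 3, M $ i $ 4])"

definition adjoint_mat :: "complex^'n^'m \<Rightarrow> complex^'m^'n"
  where "adjoint_mat A = (\<chi> i j. cnj (A $ j $ i))"

definition J_mat :: "complex^2^2"
  where "J_mat = vector [vector [0, 1], vector [- 1, 0]]"

definition self_adjoint_bc :: "complex^4^2 \<Rightarrow> bool"
  where "self_adjoint_bc M \<longleftrightarrow>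
    left_block M ** J_mat ** adjoint_mat (left_block M) =
    right_block M ** J_mat ** adjoint_mat (right_block M)"

definition rank2_matrices :: "(complex^4^2) set"
  where "rank2_matrices = {M. rank M = 2}"

definition bc_class :: "complex^4^2 \<Rightarrow> (complex^4^2) set"
  where "bc_class M = {T ** M | T :: complex^2^2. invertible T}"

definition BC :: "(complex^4^2) set set"
  where "BC = bc_class ` {M \<in> rank2_matrices. self_adjoint_bc M}"

definition quotient_topology :: "'a topology \<Rightarrow> ('a \<Rightarrow> 'b) \<Rightarrow> 'b topology"
  where "quotient_topology X f =
    topology (\<lambda>U. U \<subseteq> f ` topspace X \<and> openin X {x \<in> topspace X. f x \<in> U})"

lemma openin_quotient_topology:
  "openin (quotient_topology X f) U \<longleftrightarrow>
    U \<subseteq> f ` topspace X \<and> openin X {x \<in> topspace X. f x \<in> U}"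
proof -
  have "istopology (\<lambda>U. U \<subseteq> f ` topspace X \<and> openin X {x \<in> topspace X. f x \<in> U})"
    unfolding istopology_def
  proof (intro conjI allI impI)
    fix S T
    assume S: "S \<subseteq> f ` topspace X \<and> openin X {x \<in> topspace X. f x \<in> S}"
      and T: "T \<subseteq> f ` topspace X \<and> openin X {x \<in> topspace X. f x \<in> T}"
    show "S \<inter> T \<subseteq> f ` topspace X" using S by blast
    have "{x \<in> topspace X. f x \<in> S \<inter> T} =
        {x \<in> topspace X. f x \<in> S} \<inter> {x \<in> topspace X. f x \<in> T}" by blast
    then show "openin X {x \<in> topspace X. f x \<in> S \<inter> T}" using S T by auto
  next
    fix K
    assume K: "\<forall>S\<in>K. S \<subseteq> f ` topspace X \<and> openin X {x \<in> topspace X. f x \<in> S}"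
    show "\<Union>K \<subseteq> f ` topspace X" using K by blast
    have "{x \<in> topspace X. f x \<in> \<Union>K} = \<Union>((\<lambda>S. {x \<in> topspace X. f x \<in> S}) ` K)" by blast
    also have "openin X \<dots>" by (rule openin_Union) (use K in blast)
    finally show "openin X {x \<in> topspace X. f x \<in> \<Union>K}" .
  qed
  then show ?thesis by (simp add: quotient_topology_def)
qed

lemma topspace_quotient_topology: "topspace (quotient_topology X f) = f ` topspace X"
proof
  show "topspace (quotient_topology X f) \<subseteq> f ` topspace X"
    using openin_quotient_topology[of X f "topspace (quotient_topology X f)"] by simp
  have "{x \<in> topspace X. f x \<in> f ` topspace X} = topspace X" by blast
  then have "openin (quotient_topology X f) (f ` topspace X)"
    by (simp add: openin_quotient_topology)
  then show "f ` topspace X \<subseteq> topspace (quotient_topology X f)" by (rule openin_subset)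
qed

lemma quotient_map_quotient_topology: "quotient_map X (quotient_topology X f) f"
  by (auto simp: quotient_map_def topspace_quotient_topology openin_quotient_topology)

definition BC_top :: "(complex^4^2) set topology"
  where "BC_top = subtopology
    (quotient_topology (subtopology euclidean rank2_matrices) bc_class) BC"

type_synonym slp = "sl_equation \<times> (complex^4^2) set"

definition SLP :: "nat \<Rightarrow> slp set"
  where "SLP N = Omega N \<times> BC"

definition SLP_top :: "nat \<Rightarrow> slp topology"
  where "SLP_top N = prod_topology (Omega_top N) BC_top"

lemma topspace_SLP_top: "topspace (SLP_top N) = SLP N"
  by (auto simp: SLP_top_def SLP_def Omega_top_def BC_top_def BC_def Omega_def
      topspace_quotient_topology PiE_def Pi_def)

text \<open>Solutions and eigenvalues. A vector \<open>(y\<^sub>0, \<dots>, y\<^sub>N\<^sub>+\<^sub>1)\<close> is a function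
  vanishing beyond \<open>N + 1\<close>.\<close>

definition fwd_diff :: "(nat \<Rightarrow> complex) \<Rightarrow> nat \<Rightarrow> complex" (\<open>\<Delta>\<close>)
  where "\<Delta> y n = y (n + 1) - y n"

definition bwd_diff :: "(nat \<Rightarrow> complex) \<Rightarrow> nat \<Rightarrow> complex" (\<open>\<nabla>\<close>)
  where "\<nabla> y n = y n - y (n - 1)"

definition sl_equation_holds :: "nat \<Rightarrow> sl_equation \<Rightarrow> complex \<Rightarrow> (nat \<Rightarrow> complex) \<Rightarrow> bool"
  where "sl_equation_holds N \<omega> z y \<longleftrightarrow>
    (\<forall>n\<in>{1..N}. - \<nabla> (\<lambda>k. of_real (coeff_f \<omega> k) * \<Delta> y k) n + of_real (coeff_q \<omega> n) * y n
      = z * of_real (coeff_w \<omega> n) * y n)"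

definition bc_holds :: "nat \<Rightarrow> sl_equation \<Rightarrow> complex^4^2 \<Rightarrow> (nat \<Rightarrow> complex) \<Rightarrow> bool"
  where "bc_holds N \<omega> M y \<longleftrightarrow>
    left_block M *v vector [y 0, of_real (coeff_f \<omega> 0) * \<Delta> y 0] +
    right_block M *v vector [y N, of_real (coeff_f \<omega> N) * \<Delta> y N] = 0"

text \<open>The boundary condition does not depend on the representative, so quantifying over all
  members of the (nonempty) class is the same as choosing one.\<close>

definition solution_space :: "nat \<Rightarrow> slp \<Rightarrow> complex \<Rightarrow> (nat \<Rightarrow> complex) set"
  where "solution_space N p z = {y. (\<forall>n>N + 1. y n = 0) \<and>
    sl_equation_holds N (fst p) z y \<and> (\<forall>M\<in>snd p. bc_holds N (fst p) M y)}"

definition is_eigenvalue :: "nat \<Rightarrow> slp \<Rightarrow> complex \<Rightarrow> bool"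
  where "is_eigenvalue N p z \<longleftrightarrow> (\<exists>y\<in>solution_space N p z. y \<noteq> 0)"

definition seq_scale :: "complex \<Rightarrow> (nat \<Rightarrow> complex) \<Rightarrow> nat \<Rightarrow> complex"
  where "seq_scale c y = (\<lambda>n. c * y n)"

interpretation cseq: vector_space seq_scale
  by unfold_locales (auto simp: seq_scale_def fun_eq_iff algebra_simps)

definition multiplicity_ev :: "nat \<Rightarrow> slp \<Rightarrow> complex \<Rightarrow> nat"
  where "multiplicity_ev N p z = cseq.dim (solution_space N p z)"

text \<open>The sum below is over a finite set for every problem in \<open>SLP N\<close> with \<open>N \<ge> 2\<close>, and all
  eigenvalues of such a problem are real, so that \<open>Re\<close> only converts their type.\<close>

definition eigenvalue_mset :: "nat \<Rightarrow> slp \<Rightarrow> complex multiset"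
  where "eigenvalue_mset N p = (\<Sum>z | is_eigenvalue N p z. replicate_mset (multiplicity_ev N p z) z)"

definition num_eigenvalues :: "nat \<Rightarrow> slp \<Rightarrow> nat"
  where "num_eigenvalues N p = size (eigenvalue_mset N p)"

definition nth_eigenvalue :: "nat \<Rightarrow> nat \<Rightarrow> slp \<Rightarrow> real"
  where "nth_eigenvalue N n p = sorted_list_of_multiset (image_mset Re (eigenvalue_mset N p)) ! n"

text \<open>The value \<open>nth_eigenvalue N n p\<close> is meaningful only under the following condition.\<close>

definition nth_eigenvalue_defined :: "nat \<Rightarrow> nat \<Rightarrow> slp \<Rightarrow> bool"
  where "nth_eigenvalue_defined N n p \<longleftrightarrow> n < num_eigenvalues N p"

definition eigenvalue_function_on :: "nat \<Rightarrow> nat \<Rightarrow> slp set \<Rightarrow> bool"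
  where "eigenvalue_function_on N n S \<longleftrightarrow> (\<exists>p\<in>S. nth_eigenvalue_defined N n p)"

definition nth_eigenvalue_continuous_on :: "nat \<Rightarrow> nat \<Rightarrow> slp set \<Rightarrow> bool"
  where "nth_eigenvalue_continuous_on N n S \<longleftrightarrow> (\<forall>p\<in>S. nth_eigenvalue_defined N n p) \<and>
    continuous_map (subtopology (SLP_top N) S) euclideanreal (nth_eigenvalue N n)"

definition continuous_eigenvalue_branch :: "nat \<Rightarrow> slp set \<Rightarrow> (slp \<Rightarrow> real) \<Rightarrow> bool"
  where "continuous_eigenvalue_branch N F \<Lambda> \<longleftrightarrow> connectedin (SLP_top N) F \<and>
    continuous_map (subtopology (SLP_top N) F) euclideanreal \<Lambda> \<and>
    (\<forall>p\<in>F. is_eigenvalue N p (of_real (\<Lambda> p)))"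

definition locally_continuous_eigenvalue_branch :: "nat \<Rightarrow> slp set \<Rightarrow> (slp \<Rightarrow> real) \<Rightarrow> bool"
  where "locally_continuous_eigenvalue_branch N S \<Lambda> \<longleftrightarrow>
    (\<forall>p\<in>S. \<exists>U V. openin (subtopology (SLP_top N) S) U \<and> p \<in> U \<and> U \<subseteq> V \<and> V \<subseteq> S \<and>
      continuous_eigenvalue_branch N V \<Lambda>)"

end

theory Submission
  imports Defs "HOL-Computational_Algebra.Fundamental_Theorem_Algebra"
    "HOL-Complex_Analysis.Great_Picard"
begin

text \<open>Let \<open>\<Phi>(z)\<close> be the transfer matrix from \<open>(y\<^sub>0, f\<^sub>0 \<Delta>y\<^sub>0)\<close> to \<open>(y\<^sub>N, f\<^sub>N \<Delta>y\<^sub>N)\<close>; its entries are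
  polynomials in \<open>z\<close>. The eigenvalues are the roots of \<open>det (A + B \<Phi>(z))\<close>. Self-adjointness turns a
  left null vector \<open>s\<^sup>*\<close> of \<open>A + B \<Phi>(z)\<close> into the right null vector \<open>J A\<^sup>* s\<close> at the conjugate of \<open>z\<close>,
  and the Lagrange identity, pairing the two, shows that all roots are real and that the order of
  each root is the dimension of the eigenspace. Hence the number of eigenvalues is the degree of
  this polynomial, whose coefficients depend continuously on the problem and on the representing
  matrix. While the degree is constant the roots of real-rooted polynomials stay bounded, and a
  compactness argument shows that the sorted roots depend continuously on the coefficients. The
  result descends to \<open>BC\<close> because \<open>bc_class\<close> is an open map. Conversely, if every eigenvalue
  function is defined everywhere on the set, the numbers of eigenvalues agree; and a connected set
  is itself the neighbourhood on which each eigenvalue function is a branch.\<close>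

section \<open>The initial value problem\<close>

text \<open>The components are \<open>y\<^sub>n\<close> and \<open>f\<^sub>n \<Delta>y\<^sub>n\<close> as polynomials in the spectral parameter.\<close>

primrec sl_ivp :: "sl_equation \<Rightarrow> complex \<Rightarrow> complex \<Rightarrow> nat \<Rightarrow> complex poly \<times> complex poly"
  where
    "sl_ivp \<omega> c d 0 = ([:c:], [:d:])"
  | "sl_ivp \<omega> c d (Suc n) =
      (let y = fst (sl_ivp \<omega> c d n) + smult (of_real (fst \<omega> n)) (snd (sl_ivp \<omega> c d n))
       in (y, snd (sl_ivp \<omega> c d n)
              + [:of_real (coeff_q \<omega> (Suc n)), - of_real (coeff_w \<omega> (Suc n)):] * y))"

definition ypoly :: "sl_equation \<Rightarrow> complex \<Rightarrow> complex \<Rightarrow> nat \<Rightarrow> complex poly"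
  where "ypoly \<omega> c d n = fst (sl_ivp \<omega> c d n)"

definition xpoly :: "sl_equation \<Rightarrow> complex \<Rightarrow> complex \<Rightarrow> nat \<Rightarrow> complex poly"
  where "xpoly \<omega> c d n = snd (sl_ivp \<omega> c d n)"

lemma ypoly_0 [simp]: "ypoly \<omega> c d 0 = [:c:]"
  and xpoly_0 [simp]: "xpoly \<omega> c d 0 = [:d:]"
  by (simp_all add: ypoly_def xpoly_def)

lemma ypoly_Suc: "ypoly \<omega> c d (Suc n) = ypoly \<omega> c d n + smult (of_real (fst \<omega> n)) (xpoly \<omega> c d n)"
  by (simp add: ypoly_def xpoly_def Let_def)

lemma xpoly_Suc:
  "xpoly \<omega> c d (Suc n) = xpoly \<omega> c d n +
    [:of_real (coeff_q \<omega> (Suc n)), - of_real (coeff_w \<omega> (Suc n)):] * ypoly \<omega> c d (Suc n)"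
  by (simp add: ypoly_def xpoly_def Let_def)

section \<open>Linearity in the initial data, Wronskian and Lagrange identities\<close>

lemma ypoly_linear:
    "ypoly \<omega> c d n = smult c (ypoly \<omega> 1 0 n) + smult d (ypoly \<omega> 0 1 n)"
  and xpoly_linear:
    "xpoly \<omega> c d n = smult c (xpoly \<omega> 1 0 n) + smult d (xpoly \<omega> 0 1 n)"
proof (induction n)
  case (Suc n)
  { case 1 show ?case
      by (subst (1 2 3) ypoly_Suc, subst (1) Suc(1), subst (1) Suc(2))
        (simp add: smult_add_right algebra_simps) }
  \<comment> \<open>\<open>xpoly\<close> at \<open>Suc n\<close> is built from \<open>ypoly\<close>
    at \<open>Suc n\<close>, so the first claim at \<open>Suc n\<close> feeds the second.\<close>
  note y = this
  { case 2 show ?case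
      by (subst (1 2 3) xpoly_Suc, subst (1) Suc(2), subst (1) y)
        (simp add: smult_add_right algebra_simps del: mult_pCons_left) }
qed simp_all

lemma cnj_poly_ypoly: "cnj (poly (ypoly \<omega> c d n) z) = poly (ypoly \<omega> (cnj c) (cnj d) n) (cnj z)"
  and cnj_poly_xpoly: "cnj (poly (xpoly \<omega> c d n) z) = poly (xpoly \<omega> (cnj c) (cnj d) n) (cnj z)"
  by (induction n) (auto simp: ypoly_Suc xpoly_Suc)

text \<open>Each recursion step is a composition of two shears of the pair (\<open>ypoly\<close>,
  \<open>xpoly\<close>), so the determinant of the transfer matrix keeps its initial value
  1.\<close>

lemma wronskian:
  "poly (ypoly \<omega> 1 0 n) z * poly (xpoly \<omega> 0 1 n) z -
   poly (xpoly \<omega> 1 0 n) z * poly (ypoly \<omega> 0 1 n) z = 1"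
proof (induction n)
  case (Suc n)
  then show ?case by (simp add: ypoly_Suc xpoly_Suc algebra_simps)
qed simp

text \<open>Since 1/f, q and w are real, one step changes the skew form on the left only through the
  spectral parameter, by \<open>cnj z - z\<close> times the weighted square of the new value. Adding
  up the steps gives the sum.\<close>

lemma lagrange_identity:
  "cnj (poly (ypoly \<omega> c d n) z) * poly (xpoly \<omega> c d n) z -
   cnj (poly (xpoly \<omega> c d n) z) * poly (ypoly \<omega> c d n) z =
   cnj c * d - cnj d * c +
   (cnj z - z) * of_real (\<Sum>k\<in>{1..n}. coeff_w \<omega> k * (cmod (poly (ypoly \<omega> c d k) z))\<^sup>2)"
proof (induction n)
  case (Suc n)
  define y where "y = poly (ypoly \<omega> c d n) z"
  define x where "x = poly (xpoly \<omega> c d n) z"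
  define r q w where "r = complex_of_real (fst \<omega> n)"
    and "q = complex_of_real (coeff_q \<omega> (Suc n))" and "w = complex_of_real (coeff_w \<omega> (Suc n))"
  have cnjs: "cnj r = r" "cnj q = q" "cnj w = w"
    by (simp_all add: r_def q_def w_def)
  have ySuc: "poly (ypoly \<omega> c d (Suc n)) z = y + r * x"
    by (simp add: ypoly_Suc y_def x_def r_def)
  have xSuc: "poly (xpoly \<omega> c d (Suc n)) z = x + (q - z * w) * (y + r * x)"
    by (simp add: xpoly_Suc ySuc x_def q_def w_def algebra_simps)
  have "cnj (y + r * x) * (x + (q - z * w) * (y + r * x)) -
        cnj (x + (q - z * w) * (y + r * x)) * (y + r * x)
      = (cnj y * x - cnj x * y) + (cnj z - z) * (w * ((y + r * x) * cnj (y + r * x)))"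
    by (simp add: cnjs algebra_simps)
  also have "w * ((y + r * x) * cnj (y + r * x)) =
      of_real (coeff_w \<omega> (Suc n) * (cmod (poly (ypoly \<omega> c d (Suc n)) z))\<^sup>2)"
    by (simp add: complex_norm_square[symmetric] w_def ySuc del: complex_cnj_add)
  finally have step: "cnj (y + r * x) * (x + (q - z * w) * (y + r * x)) -
      cnj (x + (q - z * w) * (y + r * x)) * (y + r * x) =
      (cnj y * x - cnj x * y) + (cnj z - z) *
      of_real (coeff_w \<omega> (Suc n) * (cmod (poly (ypoly \<omega> c d (Suc n)) z))\<^sup>2)" .
  have "{1..Suc n} = insert (Suc n) {1..n}" by auto
  then show ?case
    unfolding xSuc ySuc step Suc.IH[folded y_def x_def]
    by (simp add: ySuc distrib_left)
qed simp

text \<open>The Lagrange identity with one factor differentiated in \<open>z\<close>: for real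
  \<open>z\<close> a step contributes only through the derivative of \<open>q - z * w\<close>, and
  the initial data contribute nothing because they are constant in \<open>z\<close>.\<close>

lemma lagrange_identity_pderiv:
  assumes "cnj z = z"
  shows "cnj (poly (ypoly \<omega> c d n) z) * poly (pderiv (xpoly \<omega> c d n)) z -
    cnj (poly (xpoly \<omega> c d n) z) * poly (pderiv (ypoly \<omega> c d n)) z =
    - of_real (\<Sum>k\<in>{1..n}. coeff_w \<omega> k * (cmod (poly (ypoly \<omega> c d k) z))\<^sup>2)"
proof (induction n)
  case (Suc n)
  define y where "y = poly (ypoly \<omega> c d n) z"
  define x where "x = poly (xpoly \<omega> c d n) z"
  define y' where "y' = poly (pderiv (ypoly \<omega> c d n)) z"
  define x' where "x' = poly (pderiv (xpoly \<omega> c d n)) z"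
  define r q w where "r = complex_of_real (fst \<omega> n)"
    and "q = complex_of_real (coeff_q \<omega> (Suc n))" and "w = complex_of_real (coeff_w \<omega> (Suc n))"
  have cnjs: "cnj r = r" "cnj q = q" "cnj w = w" "cnj z = z"
    by (simp_all add: r_def q_def w_def assms)
  have ySuc: "poly (ypoly \<omega> c d (Suc n)) z = y + r * x"
    by (simp add: ypoly_Suc y_def x_def r_def)
  have xSuc: "poly (xpoly \<omega> c d (Suc n)) z = x + (q - z * w) * (y + r * x)"
    by (simp add: xpoly_Suc ySuc x_def q_def w_def algebra_simps)
  have y'Suc: "poly (pderiv (ypoly \<omega> c d (Suc n))) z = y' + r * x'"
    by (simp add: ypoly_Suc y'_def x'_def r_def pderiv_add pderiv_smult)
  have x'Suc: "poly (pderiv (xpoly \<omega> c d (Suc n))) z =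
      x' + (q - z * w) * (y' + r * x') - w * (y + r * x)"
    by (simp add: xpoly_Suc ySuc y'Suc x'_def q_def w_def pderiv_add pderiv_mult pderiv_pCons
        del: mult_pCons_left)
  have "cnj (y + r * x) * (x' + (q - z * w) * (y' + r * x') - w * (y + r * x)) -
        cnj (x + (q - z * w) * (y + r * x)) * (y' + r * x')
      = (cnj y * x' - cnj x * y') - w * ((y + r * x) * cnj (y + r * x))"
    by (simp add: cnjs algebra_simps)
  also have "w * ((y + r * x) * cnj (y + r * x)) =
      of_real (coeff_w \<omega> (Suc n) * (cmod (poly (ypoly \<omega> c d (Suc n)) z))\<^sup>2)"
    by (simp add: complex_norm_square[symmetric] w_def ySuc del: complex_cnj_add)
  finally have step: "cnj (y + r * x) * (x' + (q - z * w) * (y' + r * x') - w * (y + r * x)) -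
      cnj (x + (q - z * w) * (y + r * x)) * (y' + r * x') =
      (cnj y * x' - cnj x * y') -
      of_real (coeff_w \<omega> (Suc n) * (cmod (poly (ypoly \<omega> c d (Suc n)) z))\<^sup>2)" .
  have "{1..Suc n} = insert (Suc n) {1..n}" by auto
  then show ?case
    unfolding xSuc ySuc x'Suc y'Suc step Suc.IH[folded y_def x_def y'_def x'_def]
    by (simp add: ySuc)
qed (simp add: pderiv_pCons)

text \<open>If the solution vanished at 1 and 2, then \<open>fst \<omega> 1 \<noteq> 0\<close> would
  force its quasi-difference at 1 to vanish, and running the recursion back to 0 would give zero
  initial data. \<open>N \<ge> 2\<close> puts both indices into the sum.\<close>

lemma weighted_norm_pos:
  assumes "\<omega> \<in> Omega N" "N \<ge> 2" "c \<noteq> 0 \<or> d \<noteq> 0"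
  shows "(\<Sum>k\<in>{1..N}. coeff_w \<omega> k * (cmod (poly (ypoly \<omega> c d k) z))\<^sup>2) > 0"
proof -
  have w: "coeff_w \<omega> k > 0" if "k \<in> {1..N}" for k
    using assms(1) that by (auto simp: Omega_def coeff_w_def PiE_def Pi_def)
  have r: "fst \<omega> 1 \<noteq> 0"
    using assms(1,2) by (auto simp: Omega_def PiE_def Pi_def)
  have nonneg: "coeff_w \<omega> k * (cmod (poly (ypoly \<omega> c d k) z))\<^sup>2 \<ge> 0" if "k \<in> {1..N}" for k
    using w[OF that] by simp
  have "poly (ypoly \<omega> c d 1) z \<noteq> 0 \<or> poly (ypoly \<omega> c d 2) z \<noteq> 0"
  proof (rule ccontr)
    assume *: "\<not> ?thesis"
    then have "poly (xpoly \<omega> c d 1) z = 0"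
      using r by (simp add: numeral_2_eq_2 ypoly_Suc)
    with * show False
      using assms(3) by (simp add: ypoly_Suc xpoly_Suc)
  qed
  then obtain k where k: "k \<in> {1..N}" "poly (ypoly \<omega> c d k) z \<noteq> 0"
    using assms(2) by (metis atLeastAtMost_iff one_le_numeral order_refl order_trans)
  then have "coeff_w \<omega> k * (cmod (poly (ypoly \<omega> c d k) z))\<^sup>2 > 0"
    using w by simp
  then show ?thesis
    using k(1) nonneg by (intro sum_pos2[of _ k]) auto
qed

section \<open>Singular 2 by 2 matrices of polynomials\<close>

text \<open>A column (a, b) is annihilated by the row (b, -a); the vanishing determinant says that
  this row annihilates the other column too. A nonzero column is chosen when there is one.\<close>

lemma singular_2x2_left_null:
  fixes m11 :: "'a::field"
  assumes "m11 * m22 - m12 * m21 = 0"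
  obtains t1 t2 where "t1 \<noteq> 0 \<or> t2 \<noteq> 0" "t1 * m11 + t2 * m21 = 0" "t1 * m12 + t2 * m22 = 0"
proof (cases "m11 = 0 \<and> m21 = 0")
  case True
  show thesis
  proof (cases "m12 = 0 \<and> m22 = 0")
    case True
    with \<open>m11 = 0 \<and> m21 = 0\<close> show thesis by (intro that[of 1 0]) auto
  next
    case False
    with \<open>m11 = 0 \<and> m21 = 0\<close> show thesis by (intro that[of m22 "- m12"]) auto
  qed
next
  case False
  with assms show thesis by (intro that[of m21 "- m11"]) (auto simp: algebra_simps)
qed

context
  fixes p11 p12 p21 p22 :: "complex poly" and z :: complex
  assumes semisimple: "\<And>t1 t2. \<lbrakk>t1 \<noteq> 0 \<or> t2 \<noteq> 0;
      t1 * poly p11 z + t2 * poly p21 z = 0; t1 * poly p12 z + t2 * poly p22 z = 0\<rbrakk> \<Longrightarrow>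
    \<exists>v1 v2. poly p11 z * v1 + poly p12 z * v2 = 0 \<and> poly p21 z * v1 + poly p22 z * v2 = 0 \<and>
      t1 * (poly (pderiv p11) z * v1 + poly (pderiv p12) z * v2) +
      t2 * (poly (pderiv p21) z * v1 + poly (pderiv p22) z * v2) \<noteq> 0"
begin

text \<open>\<open>semisimple\<close> lets every left null vector pair nontrivially with some right
  null vector through the derivative, which excludes Jordan chains of length two. In the rank-one
  case this makes the derivative of the determinant nonzero at \<open>z\<close>.\<close>

lemma order_det_rank_1:
  assumes det: "poly (p11 * p22 - p12 * p21) z = 0"
    and nz: "poly p11 z \<noteq> 0 \<or> poly p12 z \<noteq> 0 \<or> poly p21 z \<noteq> 0 \<or> poly p22 z \<noteq> 0"
  shows "order z (p11 * p22 - p12 * p21) = 1"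
proof -
  define G where "G = p11 * p22 - p12 * p21"
  define a11 a12 a21 a22 where "a11 = poly p11 z" and "a12 = poly p12 z"
    and "a21 = poly p21 z" and "a22 = poly p22 z"
  define b11 b12 b21 b22 where "b11 = poly (pderiv p11) z" and "b12 = poly (pderiv p12) z"
    and "b21 = poly (pderiv p21) z" and "b22 = poly (pderiv p22) z"
  have "a11 * a22 - a12 * a21 = 0"
    using det by (simp add: a11_def a12_def a21_def a22_def)
  then obtain t1 t2 where t: "t1 \<noteq> 0 \<or> t2 \<noteq> 0" "t1 * a11 + t2 * a21 = 0" "t1 * a12 + t2 * a22 = 0"
    by (rule singular_2x2_left_null)
  then obtain v1 v2 where v: "a11 * v1 + a12 * v2 = 0" "a21 * v1 + a22 * v2 = 0"
    and pairing: "t1 * (b11 * v1 + b12 * v2) + t2 * (b21 * v1 + b22 * v2) \<noteq> 0"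
    using semisimple[of t1 t2] unfolding a11_def a12_def a21_def a22_def b11_def b12_def b21_def b22_def
    by blast
  define g where "g = b11 * a22 + a11 * b22 - b12 * a21 - a12 * b21"
  define \<tau> where "\<tau> = t1 * (b11 * v1 + b12 * v2) + t2 * (b21 * v1 + b22 * v2)"
  \<comment> \<open>The adjugate is a multiple of \<open>v t\<^sup>T\<close>, and \<open>g\<close> is the trace of the adjugate times the derivative.\<close>
  have "t1 * v1 * g = a22 * \<tau>" "t2 * v1 * g = - a12 * \<tau>"
       "t1 * v2 * g = - a21 * \<tau>" "t2 * v2 * g = a11 * \<tau>"
    using t(2,3) v unfolding g_def \<tau>_def by algebra+
  moreover have "\<tau> \<noteq> 0" using pairing by (simp add: \<tau>_def)
  ultimately have "g \<noteq> 0"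
    using nz by (auto simp: a11_def a12_def a21_def a22_def)
  moreover have "poly (pderiv G) z = g"
    by (simp add: G_def g_def pderiv_diff pderiv_mult a11_def a12_def a21_def a22_def
        b11_def b12_def b21_def b22_def algebra_simps)
  ultimately have "order z (pderiv G) = 0" "G \<noteq> 0"
    by (auto intro!: order_0I)
  then show ?thesis
    using order_pderiv[of G z] det by (simp add: G_def)
qed

text \<open>All entries are divisible by the linear factor at \<open>z\<close>, so the determinant
  contains its square. The quotients take at \<open>z\<close> the values of the derivatives; a left
  null vector of that matrix would pair to zero with everything, contrary to
  \<open>semisimple\<close>.\<close>

lemma order_det_rank_0:
  assumes z: "poly p11 z = 0" "poly p12 z = 0" "poly p21 z = 0" "poly p22 z = 0"
  shows "order z (p11 * p22 - p12 * p21) = 2"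
proof -
  obtain q11 q12 q21 q22 where q: "p11 = [:-z, 1:] * q11" "p12 = [:-z, 1:] * q12"
      "p21 = [:-z, 1:] * q21" "p22 = [:-z, 1:] * q22"
    using z by (meson dvdE poly_eq_0_iff_dvd)
  have pderiv_eq: "poly (pderiv ([:-z, 1:] * r)) z = poly r z" for r
    by (simp add: pderiv_mult pderiv_pCons del: mult_pCons_left)
  define Q where "Q = q11 * q22 - q12 * q21"
  have Q: "poly Q z \<noteq> 0"
  proof
    assume "poly Q z = 0"
    then have "poly q11 z * poly q22 z - poly q12 z * poly q21 z = 0"
      by (simp add: Q_def)
    then obtain t1 t2 where t: "t1 \<noteq> 0 \<or> t2 \<noteq> 0" "t1 * poly q11 z + t2 * poly q21 z = 0"
        "t1 * poly q12 z + t2 * poly q22 z = 0"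
      by (rule singular_2x2_left_null)
    obtain v1 v2 where "t1 * (poly q11 z * v1 + poly q12 z * v2) +
        t2 * (poly q21 z * v1 + poly q22 z * v2) \<noteq> 0"
      using semisimple[OF t(1)] z unfolding q pderiv_eq by auto
    moreover have "t1 * (poly q11 z * v1 + poly q12 z * v2) +
        t2 * (poly q21 z * v1 + poly q22 z * v2) =
        (t1 * poly q11 z + t2 * poly q21 z) * v1 + (t1 * poly q12 z + t2 * poly q22 z) * v2"
      by (simp add: algebra_simps)
    ultimately show False using t(2,3) by simp
  qed
  have eq: "p11 * p22 - p12 * p21 = [:-z, 1:] ^ 2 * Q"
    unfolding q Q_def power2_eq_square by (simp only: algebra_simps)
  have "[:-z, 1:] ^ 2 * Q \<noteq> 0"
    using Q by (metis mult_eq_0_iff one_neq_zero pCons_eq_0_iff poly_0 power_not_zero)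
  from order_mult[OF this, of z] show ?thesis
    using order_power_n_n[of z 2] order_0I[OF Q] unfolding eq by linarith
qed

end

section \<open>The characteristic polynomial\<close>

text \<open>Row \<open>i\<close> of A + B \<Phi> applied to the initial vector (c, d).\<close>

definition bc_poly :: "nat \<Rightarrow> sl_equation \<Rightarrow> complex^4^2 \<Rightarrow> complex \<Rightarrow> complex \<Rightarrow> 2 \<Rightarrow> complex poly"
  where "bc_poly N \<omega> M c d i = [:M $ i $ 1 * c + M $ i $ 2 * d:] +
    smult (M $ i $ 3) (ypoly \<omega> c d N) + smult (M $ i $ 4) (xpoly \<omega> c d N)"

text \<open>The determinant of A + B \<Phi>, its columns taken at the initial vectors (1, 0) and (0,
  1).\<close>

definition sl_charpoly :: "nat \<Rightarrow> sl_equation \<Rightarrow> complex^4^2 \<Rightarrow> complex poly"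
  where "sl_charpoly N \<omega> M =
    bc_poly N \<omega> M 1 0 1 * bc_poly N \<omega> M 0 1 2 - bc_poly N \<omega> M 0 1 1 * bc_poly N \<omega> M 1 0 2"

lemma bc_poly_linear:
  "bc_poly N \<omega> M c d i = smult c (bc_poly N \<omega> M 1 0 i) + smult d (bc_poly N \<omega> M 0 1 i)"
  unfolding bc_poly_def
  by (subst ypoly_linear, subst xpoly_linear) (simp add: smult_add_right algebra_simps)

lemma rank_eq_2_iff:
  fixes M :: "'a::field^'n^2"
  shows "rank M = 2 \<longleftrightarrow>
    (\<forall>s1 s2. (\<forall>j. s1 * M $ 1 $ j + s2 * M $ 2 $ j = 0) \<longrightarrow> s1 = 0 \<and> s2 = 0)"
proof -
  have rows: "rows M = {M $ 1, M $ 2}"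
    by (auto simp: rows_def row_def exhaust_2) (metis exhaust_2)+
  have *: "(\<forall>j. s1 * M $ 1 $ j + s2 * M $ 2 $ j = 0) \<longleftrightarrow> s1 *s M $ 1 + s2 *s M $ 2 = 0" for s1 s2
    by (simp add: vec_eq_iff)
  \<comment> \<open>The set of rows collapses to a singleton when the rows coincide, so distinctness
    is recorded along with independence.\<close>
  have "rank M = 2 \<longleftrightarrow> M $ 1 \<noteq> M $ 2 \<and> vec.independent {M $ 1, M $ 2}"
    unfolding row_rank_def_gen rows
  proof
    assume 2: "vec.dim {M $ 1, M $ 2} = 2"
    have "M $ 1 \<noteq> M $ 2"
    proof
      assume "M $ 1 = M $ 2"
      then show False
        using 2 vec.dim_le_card[of "{M $ 1}" "{M $ 1}"] vec.span_superset[of "{M $ 1}"] by simp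
    qed
    moreover have "card {M $ 1, M $ 2} \<le> 2" by (simp add: card_insert_if)
    with 2 have "vec.independent {M $ 1, M $ 2}"
      by (intro vec.card_le_dim_spanning[of _ "{M $ 1, M $ 2}"]) (auto simp: vec.span_base)
    ultimately show "M $ 1 \<noteq> M $ 2 \<and> vec.independent {M $ 1, M $ 2}" by blast
  qed (simp add: vec.dim_eq_card_independent)
  also have "\<dots> \<longleftrightarrow> (\<forall>s1 s2. s1 *s M $ 1 + s2 *s M $ 2 = 0 \<longrightarrow> s1 = 0 \<and> s2 = 0)"
    (is "?L \<longleftrightarrow> ?R")
  proof
    assume L: ?L
    show ?R
    proof (intro allI impI)
      fix s1 s2 assume s: "s1 *s M $ 1 + s2 *s M $ 2 = 0"
      have "(if v = M $ 1 then s1 else s2) = 0" if "v \<in> {M $ 1, M $ 2}" for v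
        using that L s
        by (intro vec.independentD[of "{M $ 1, M $ 2}" "{M $ 1, M $ 2}"
              "\<lambda>v. if v = M $ 1 then s1 else s2"]) auto
      from this[of "M $ 1"] this[of "M $ 2"] L show "s1 = 0 \<and> s2 = 0" by auto
    qed
  next
    assume R: ?R
    have "M $ 1 \<noteq> M $ 2"
      using R[rule_format, of 1 "-1"] by auto
    moreover have "M $ 2 \<noteq> 0" using R[rule_format, of 0 1] by auto
    moreover have "M $ 1 \<notin> vec.span {M $ 2}"
    proof
      assume "M $ 1 \<in> vec.span {M $ 2}"
      then obtain k where "M $ 1 = k *s M $ 2"
        by (auto simp: vec.span_singleton)
      then show False using R[rule_format, of 1 "-k"] by (auto simp: vec_eq_iff)
    qed
    ultimately show ?L by (simp add: vec.independent_insert)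
  qed
  finally show ?thesis by (simp add: *)
qed

lemma self_adjoint_bc_entries:
  "self_adjoint_bc M \<longleftrightarrow> (\<forall>i j.
    M $ i $ 1 * cnj (M $ j $ 2) - M $ i $ 2 * cnj (M $ j $ 1) =
    M $ i $ 3 * cnj (M $ j $ 4) - M $ i $ 4 * cnj (M $ j $ 3))"
  unfolding self_adjoint_bc_def vec_eq_iff
  by (simp add: matrix_matrix_mult_def sum_2 left_block_def right_block_def adjoint_mat_def J_mat_def)

text \<open>A left null vector \<open>t\<close> of \<open>A + B \<Phi>(z)\<close> yields the right null vector \<open>J A\<^sup>* s\<close>, \<open>s\<close> the
  conjugate of \<open>t\<close>, of \<open>A + B \<Phi>(cnj z)\<close>, and \<open>\<Phi>(cnj z)\<close> maps it to \<open>- J B\<^sup>* s\<close>.\<close>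

lemma left_null_pairing:
  assumes \<omega>: "\<omega> \<in> Omega N" and N: "N \<ge> 2" and rank: "rank M = 2" and sa: "self_adjoint_bc M"
    and t: "t1 \<noteq> 0 \<or> t2 \<noteq> 0"
    and null: "t1 * poly (bc_poly N \<omega> M 1 0 1) z + t2 * poly (bc_poly N \<omega> M 1 0 2) z = 0"
      "t1 * poly (bc_poly N \<omega> M 0 1 1) z + t2 * poly (bc_poly N \<omega> M 0 1 2) z = 0"
  shows "cnj z = z"
    and "\<exists>c d. poly (bc_poly N \<omega> M c d 1) z = 0 \<and> poly (bc_poly N \<omega> M c d 2) z = 0 \<and>
      t1 * poly (pderiv (bc_poly N \<omega> M c d 1)) z + t2 * poly (pderiv (bc_poly N \<omega> M c d 2)) z \<noteq> 0"
proof -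
  \<comment> \<open>With s the conjugate of (t1, t2), the entries \<open>\<gamma> 1\<close>,
    \<open>\<gamma> 2\<close> form \<open>A\<^sup>* s\<close> and \<open>\<gamma> 3\<close>,
    \<open>\<gamma> 4\<close> form \<open>B\<^sup>* s\<close>; hence (c, d) is
    \<open>J A\<^sup>* s\<close>.\<close>
  define \<gamma> where "\<gamma> j = cnj t1 * cnj (M $ 1 $ j) + cnj t2 * cnj (M $ 2 $ j)" for j
  define c d where "c = \<gamma> 2" and "d = - \<gamma> 1"
  define Y1 X1 Y2 X2 where "Y1 = poly (ypoly \<omega> 1 0 N) (cnj z)" and "X1 = poly (xpoly \<omega> 1 0 N) (cnj z)"
    and "Y2 = poly (ypoly \<omega> 0 1 N) (cnj z)" and "X2 = poly (xpoly \<omega> 0 1 N) (cnj z)"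
  have W: "Y1 * X2 - X1 * Y2 = 1"
    unfolding Y1_def X1_def Y2_def X2_def by (rule wronskian)
  have g1: "\<gamma> 1 + \<gamma> 3 * Y1 + \<gamma> 4 * X1 = 0"
    using arg_cong[OF null(1), of cnj]
    by (simp add: bc_poly_def cnj_poly_ypoly cnj_poly_xpoly \<gamma>_def Y1_def X1_def algebra_simps)
  have g2: "\<gamma> 2 + \<gamma> 3 * Y2 + \<gamma> 4 * X2 = 0"
    using arg_cong[OF null(2), of cnj]
    by (simp add: bc_poly_def cnj_poly_ypoly cnj_poly_xpoly \<gamma>_def Y2_def X2_def algebra_simps)
  \<comment> \<open>Eliminating \<open>\<gamma> 1\<close> and \<open>\<gamma> 2\<close> by
    \<open>g1\<close> and \<open>g2\<close> leaves \<open>- \<gamma> 4\<close> times the Wronskian;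
    the value of \<open>xpoly\<close> below arises in the same way.\<close>
  have y: "poly (ypoly \<omega> c d N) (cnj z) = - \<gamma> 4"
  proof -
    have "poly (ypoly \<omega> c d N) (cnj z) = c * Y1 + d * Y2"
      by (subst ypoly_linear) (simp add: Y1_def Y2_def)
    also have "\<dots> = - \<gamma> 4"
      using W g1 g2 unfolding c_def d_def by algebra
    finally show ?thesis .
  qed
  have x: "poly (xpoly \<omega> c d N) (cnj z) = \<gamma> 3"
  proof -
    have "poly (xpoly \<omega> c d N) (cnj z) = c * X1 + d * X2"
      by (subst xpoly_linear) (simp add: X1_def X2_def)
    also have "\<dots> = \<gamma> 3"
      using W g1 g2 unfolding c_def d_def by algebra
    finally show ?thesis .
  qed
  \<comment> \<open>Zero initial data would give zero end values, hence all
    \<open>\<gamma> j\<close> would vanish: a nontrivial relation between the rows of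
    \<open>M\<close>.\<close>
  have cd: "c \<noteq> 0 \<or> d \<noteq> 0"
  proof (rule ccontr)
    assume *: "\<not> ?thesis"
    then have "ypoly \<omega> c d N = 0" "xpoly \<omega> c d N = 0"
      by (subst ypoly_linear xpoly_linear; simp)+
    with * x y have "\<gamma> 1 = 0" "\<gamma> 2 = 0" "\<gamma> 3 = 0" "\<gamma> 4 = 0"
      by (auto simp: c_def d_def)
    then have "\<gamma> j = 0" for j
      using exhaust_4[of j] by auto
    then have "cnj (\<gamma> j) = 0" for j by simp
    then have "t1 * M $ 1 $ j + t2 * M $ 2 $ j = 0" for j
      by (simp add: \<gamma>_def)
    with rank have "t1 = 0 \<and> t2 = 0"
      unfolding rank_eq_2_iff by blast
    with t show False by simp
  qed
  note pos = weighted_norm_pos[OF \<omega> N cd]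
  have sa': "M $ i $ 1 * cnj (M $ j $ 2) - M $ i $ 2 * cnj (M $ j $ 1) =
    M $ i $ 3 * cnj (M $ j $ 4) - M $ i $ 4 * cnj (M $ j $ 3)" for i j
    using sa unfolding self_adjoint_bc_entries by blast
  \<comment> \<open>Self-adjointness applied to s, that is
    \<open>A J A\<^sup>* s = B J B\<^sup>* s\<close> row by row; contracting once more with the
    conjugate of s gives \<open>sa_\<gamma>\<gamma>\<close>.\<close>
  have sa_\<gamma>: "M $ i $ 1 * \<gamma> 2 - M $ i $ 2 * \<gamma> 1 = M $ i $ 3 * \<gamma> 4 - M $ i $ 4 * \<gamma> 3" for i
  proof -
    have "M $ i $ 1 * \<gamma> 2 - M $ i $ 2 * \<gamma> 1 =
        cnj t1 * (M $ i $ 1 * cnj (M $ 1 $ 2) - M $ i $ 2 * cnj (M $ 1 $ 1)) +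
        cnj t2 * (M $ i $ 1 * cnj (M $ 2 $ 2) - M $ i $ 2 * cnj (M $ 2 $ 1))"
      by (simp add: \<gamma>_def algebra_simps)
    also have "\<dots> = M $ i $ 3 * \<gamma> 4 - M $ i $ 4 * \<gamma> 3"
      unfolding sa' by (simp add: \<gamma>_def algebra_simps)
    finally show ?thesis .
  qed
  have cnj_\<gamma>: "cnj (\<gamma> j) = t1 * M $ 1 $ j + t2 * M $ 2 $ j" for j
    by (simp add: \<gamma>_def)
  have sa_\<gamma>\<gamma>: "cnj (\<gamma> 1) * \<gamma> 2 - cnj (\<gamma> 2) * \<gamma> 1 = cnj (\<gamma> 3) * \<gamma> 4 - cnj (\<gamma> 4) * \<gamma> 3"
  proof -
    have "cnj (\<gamma> 1) * \<gamma> 2 - cnj (\<gamma> 2) * \<gamma> 1 =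
        t1 * (M $ 1 $ 1 * \<gamma> 2 - M $ 1 $ 2 * \<gamma> 1) + t2 * (M $ 2 $ 1 * \<gamma> 2 - M $ 2 $ 2 * \<gamma> 1)"
      by (simp add: cnj_\<gamma> algebra_simps)
    also have "\<dots> = cnj (\<gamma> 3) * \<gamma> 4 - cnj (\<gamma> 4) * \<gamma> 3"
      unfolding sa_\<gamma> by (simp add: cnj_\<gamma> algebra_simps)
    finally show ?thesis .
  qed
  \<comment> \<open>The skew form has the same value at both ends by
    \<open>sa_\<gamma>\<gamma>\<close>, so the Lagrange identity leaves the imaginary part of
    \<open>z\<close> times a positive sum.\<close>
  have "cnj c * d - cnj d * c +
      (z - cnj z) * of_real (\<Sum>k\<in>{1..N}. coeff_w \<omega> k * (cmod (poly (ypoly \<omega> c d k) (cnj z)))\<^sup>2) =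
      cnj (- \<gamma> 4) * \<gamma> 3 - cnj (\<gamma> 3) * (- \<gamma> 4)"
    using lagrange_identity[of \<omega> c d N "cnj z"] by (simp add: x y)
  also have "\<dots> = cnj c * d - cnj d * c"
    using sa_\<gamma>\<gamma> by (simp add: c_def d_def algebra_simps)
  finally have "(z - cnj z) *
      of_real (\<Sum>k\<in>{1..N}. coeff_w \<omega> k * (cmod (poly (ypoly \<omega> c d k) (cnj z)))\<^sup>2) = 0"
    by simp
  then have "z - cnj z = 0"
    using pos[of "cnj z"] unfolding mult_eq_0_iff of_real_eq_0_iff by (metis less_irrefl)
  then show real: "cnj z = z" by simp
  have "poly (bc_poly N \<omega> M c d i) z = 0" for i
    using sa_\<gamma>[of i] x y by (simp add: bc_poly_def real c_def d_def algebra_simps)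
  \<comment> \<open>The A part is constant in \<open>z\<close>. As the end values are
    \<open>- \<gamma> 4\<close> and \<open>\<gamma> 3\<close>, what remains is the negative of the
    left side of \<open>lagrange_identity_pderiv\<close>.\<close>
  moreover have "t1 * poly (pderiv (bc_poly N \<omega> M c d 1)) z + t2 * poly (pderiv (bc_poly N \<omega> M c d 2)) z =
      cnj (\<gamma> 3) * poly (pderiv (ypoly \<omega> c d N)) z + cnj (\<gamma> 4) * poly (pderiv (xpoly \<omega> c d N)) z"
    by (simp add: bc_poly_def pderiv_add pderiv_smult pderiv_pCons cnj_\<gamma> algebra_simps)
  moreover have "\<dots> = of_real (\<Sum>k\<in>{1..N}. coeff_w \<omega> k * (cmod (poly (ypoly \<omega> c d k) z))\<^sup>2)"
    using lagrange_identity_pderiv[OF real, of \<omega> c d N] x y by (simp add: real algebra_simps)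
  moreover have "\<dots> \<noteq> 0"
    unfolding of_real_eq_0_iff using pos[of z] by linarith
  ultimately show "\<exists>c d. poly (bc_poly N \<omega> M c d 1) z = 0 \<and> poly (bc_poly N \<omega> M c d 2) z = 0 \<and>
      t1 * poly (pderiv (bc_poly N \<omega> M c d 1)) z + t2 * poly (pderiv (bc_poly N \<omega> M c d 2)) z \<noteq> 0"
    by metis
qed

context
  fixes N \<omega> M
  assumes \<omega>: "\<omega> \<in> Omega N" and N: "N \<ge> 2" and rank: "rank M = 2" and sa: "self_adjoint_bc M"
begin

lemma sl_charpoly_root_real:
  assumes "poly (sl_charpoly N \<omega> M) z = 0"
  shows "z \<in> \<real>"
proof -
  have "poly (bc_poly N \<omega> M 1 0 1) z * poly (bc_poly N \<omega> M 0 1 2) z -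
      poly (bc_poly N \<omega> M 0 1 1) z * poly (bc_poly N \<omega> M 1 0 2) z = 0"
    using assms by (simp add: sl_charpoly_def)
  then obtain t1 t2 where "t1 \<noteq> 0 \<or> t2 \<noteq> 0"
    "t1 * poly (bc_poly N \<omega> M 1 0 1) z + t2 * poly (bc_poly N \<omega> M 1 0 2) z = 0"
    "t1 * poly (bc_poly N \<omega> M 0 1 1) z + t2 * poly (bc_poly N \<omega> M 0 1 2) z = 0"
    by (rule singular_2x2_left_null)
  then show ?thesis
    using left_null_pairing(1)[OF \<omega> N rank sa] Reals_cnj_iff by blast
qed

text \<open>The zero polynomial would have the nonreal root \<open>\<i>\<close>.\<close>

lemma sl_charpoly_nonzero: "sl_charpoly N \<omega> M \<noteq> 0"
proof
  assume "sl_charpoly N \<omega> M = 0"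
  then have "\<i> \<in> \<real>" by (intro sl_charpoly_root_real) simp
  then show False by (simp add: complex_is_Real_iff)
qed

text \<open>Recasts \<open>left_null_pairing\<close> as the hypothesis \<open>semisimple\<close> of
  the determinant lemmas, with v = (c, d).\<close>

lemma sl_charpoly_semisimple:
  assumes "t1 \<noteq> 0 \<or> t2 \<noteq> 0"
    "t1 * poly (bc_poly N \<omega> M 1 0 1) z + t2 * poly (bc_poly N \<omega> M 1 0 2) z = 0"
    "t1 * poly (bc_poly N \<omega> M 0 1 1) z + t2 * poly (bc_poly N \<omega> M 0 1 2) z = 0"
  shows "\<exists>v1 v2. poly (bc_poly N \<omega> M 1 0 1) z * v1 + poly (bc_poly N \<omega> M 0 1 1) z * v2 = 0 \<and>
      poly (bc_poly N \<omega> M 1 0 2) z * v1 + poly (bc_poly N \<omega> M 0 1 2) z * v2 = 0 \<and>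
      t1 * (poly (pderiv (bc_poly N \<omega> M 1 0 1)) z * v1 + poly (pderiv (bc_poly N \<omega> M 0 1 1)) z * v2) +
      t2 * (poly (pderiv (bc_poly N \<omega> M 1 0 2)) z * v1 + poly (pderiv (bc_poly N \<omega> M 0 1 2)) z * v2) \<noteq> 0"
proof -
  have "poly (bc_poly N \<omega> M c d i) z = poly (bc_poly N \<omega> M 1 0 i) z * c + poly (bc_poly N \<omega> M 0 1 i) z * d"
    "poly (pderiv (bc_poly N \<omega> M c d i)) z =
      poly (pderiv (bc_poly N \<omega> M 1 0 i)) z * c + poly (pderiv (bc_poly N \<omega> M 0 1 i)) z * d" for c d i
    by (subst bc_poly_linear; simp add: pderiv_add pderiv_smult mult.commute)+
  then show ?thesis
    using left_null_pairing(2)[OF \<omega> N rank sa assms] by metis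
qed

lemmas order_sl_charpoly_rank_1 = order_det_rank_1[OF sl_charpoly_semisimple, folded sl_charpoly_def]
  and order_sl_charpoly_rank_0 = order_det_rank_0[OF sl_charpoly_semisimple, folded sl_charpoly_def]

end

section \<open>Eigenvalues as roots of the characteristic polynomial\<close>

lemma bc_holds_iff:
  "bc_holds N \<omega> M y \<longleftrightarrow>
    (\<forall>i. M $ i $ 1 * y 0 + M $ i $ 2 * (of_real (coeff_f \<omega> 0) * \<Delta> y 0) +
      M $ i $ 3 * y N + M $ i $ 4 * (of_real (coeff_f \<omega> N) * \<Delta> y N) = 0)"
  unfolding bc_holds_def vec_eq_iff
  by (simp add: matrix_vector_mult_def sum_2 left_block_def right_block_def algebra_simps)

lemma bc_holds_mult:
  assumes "bc_holds N \<omega> M y"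
  shows "bc_holds N \<omega> (T ** M) y"
proof -
  have M: "M $ i $ 1 * y 0 + M $ i $ 2 * (of_real (coeff_f \<omega> 0) * \<Delta> y 0) +
      M $ i $ 3 * y N + M $ i $ 4 * (of_real (coeff_f \<omega> N) * \<Delta> y N) = 0" for i
    using assms by (simp add: bc_holds_iff)
  have "(T ** M) $ i $ 1 * y 0 + (T ** M) $ i $ 2 * (of_real (coeff_f \<omega> 0) * \<Delta> y 0) +
      (T ** M) $ i $ 3 * y N + (T ** M) $ i $ 4 * (of_real (coeff_f \<omega> N) * \<Delta> y N) = 0" for i
    using M[of 1] M[of 2] unfolding matrix_matrix_mult_def vec_lambda_beta sum_2 by algebra
  then show ?thesis by (simp add: bc_holds_iff)
qed

lemma bc_class_self: "M \<in> bc_class M"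
proof -
  have "invertible (mat 1 :: complex^2^2)"
    unfolding invertible_def by (metis matrix_mul_lid)
  then show ?thesis
    unfolding bc_class_def by (metis (mono_tags, lifting) matrix_mul_lid mem_Collect_eq)
qed

lemma bc_holds_bc_class: "(\<forall>M'\<in>bc_class M. bc_holds N \<omega> M' y) \<longleftrightarrow> bc_holds N \<omega> M y"
proof
  assume "bc_holds N \<omega> M y"
  then show "\<forall>M'\<in>bc_class M. bc_holds N \<omega> M' y"
    by (auto simp only: bc_class_def mem_Collect_eq intro: bc_holds_mult)
qed (use bc_class_self in blast)

section \<open>Solutions parametrized by their initial data\<close>

text \<open>The cut-off beyond \<open>N + 1\<close> matches the encoding of vectors in
  \<open>solution_space\<close>.\<close>

definition sl_solution :: "nat \<Rightarrow> sl_equation \<Rightarrow> complex \<Rightarrow> complex \<Rightarrow> complex \<Rightarrow> nat \<Rightarrow> complex"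
  where "sl_solution N \<omega> z c d n = (if n \<le> N + 1 then poly (ypoly \<omega> c d n) z else 0)"

lemma sl_solution_linear:
  "sl_solution N \<omega> z c d =
    seq_scale c (sl_solution N \<omega> z 1 0) + seq_scale d (sl_solution N \<omega> z 0 1)"
proof
  fix n
  show "sl_solution N \<omega> z c d n =
    (seq_scale c (sl_solution N \<omega> z 1 0) + seq_scale d (sl_solution N \<omega> z 0 1)) n"
    unfolding sl_solution_def by (subst ypoly_linear) (simp add: seq_scale_def)
qed

lemma sl_solution_scale:
  "sl_solution N \<omega> z (k * c) (k * d) = seq_scale k (sl_solution N \<omega> z c d)"
  by (subst (1 2) sl_solution_linear) (simp add: seq_scale_def fun_eq_iff algebra_simps)

context
  fixes N \<omega>
  assumes \<omega>: "\<omega> \<in> Omega N"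
begin

lemma fst_nonzero: "k \<le> N \<Longrightarrow> fst \<omega> k \<noteq> 0"
  using \<omega> by (auto simp: Omega_def PiE_def Pi_def)

lemma sl_solution_eq_0_iff: "sl_solution N \<omega> z c d = 0 \<longleftrightarrow> c = 0 \<and> d = 0"
proof
  assume *: "sl_solution N \<omega> z c d = 0"
  have "sl_solution N \<omega> z c d 0 = 0" "sl_solution N \<omega> z c d 1 = 0"
    unfolding * by simp_all
  then show "c = 0 \<and> d = 0"
    using fst_nonzero[of 0] by (auto simp: sl_solution_def ypoly_Suc)
next
  assume "c = 0 \<and> d = 0"
  then show "sl_solution N \<omega> z c d = 0"
    by (subst sl_solution_linear) (simp add: fun_eq_iff seq_scale_def)
qed

lemma quasi_diff_sl_solution:
  assumes "k \<le> N"
  shows "of_real (coeff_f \<omega> k) * \<Delta> (sl_solution N \<omega> z c d) k = poly (xpoly \<omega> c d k) z"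
  using assms fst_nonzero[OF assms]
  by (simp add: sl_solution_def fwd_diff_def ypoly_Suc coeff_f_def)

text \<open>With the quasi-difference as a second unknown the equation becomes the first-order
  recursion behind \<open>ypoly\<close> and \<open>xpoly\<close>, so the initial pair determines the
  solution.\<close>

lemma sl_equation_holds_iff:
  "(\<forall>n>N + 1. y n = 0) \<and> sl_equation_holds N \<omega> z y \<longleftrightarrow> (\<exists>c d. y = sl_solution N \<omega> z c d)"
proof
  assume *: "(\<forall>n>N + 1. y n = 0) \<and> sl_equation_holds N \<omega> z y"
  define x where "x k = of_real (coeff_f \<omega> k) * \<Delta> y k" for k
  have y_Suc: "y (Suc k) = y k + of_real (fst \<omega> k) * x k" if "k \<le> N" for k
    using fst_nonzero[OF that] by (simp add: x_def coeff_f_def fwd_diff_def)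
  have x_Suc: "x (Suc k) = x k + (of_real (coeff_q \<omega> (Suc k)) - z * of_real (coeff_w \<omega> (Suc k))) * y (Suc k)"
    if "k < N" for k
  proof -
    have "- (x (Suc k) - x k) + of_real (coeff_q \<omega> (Suc k)) * y (Suc k) =
        z * of_real (coeff_w \<omega> (Suc k)) * y (Suc k)"
      using * that unfolding sl_equation_holds_def bwd_diff_def x_def
      by (metis One_nat_def Suc_leI atLeastAtMost_iff diff_Suc_1 le_add1 plus_1_eq_Suc)
    then show ?thesis by (simp add: algebra_simps)
  qed
  have yx: "k \<le> N \<Longrightarrow> y k = poly (ypoly \<omega> (y 0) (x 0) k) z \<and> x k = poly (xpoly \<omega> (y 0) (x 0) k) z" for k
  proof (induction k)
    case (Suc k)
    have "y (Suc k) = poly (ypoly \<omega> (y 0) (x 0) (Suc k)) z"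
      using Suc y_Suc[of k] by (simp add: ypoly_Suc)
    then show ?case
      using Suc x_Suc[of k] by (simp add: xpoly_Suc algebra_simps)
  qed simp
  have "y n = sl_solution N \<omega> z (y 0) (x 0) n" for n
  proof -
    \<comment> \<open>The value at \<open>Suc N\<close> lies beyond the last equation to be solved
      for a quasi-difference; it is fixed by the value and quasi-difference at
      \<open>N\<close>.\<close>
    consider "n \<le> N" | "n = Suc N" | "n > N + 1" by linarith
    then show ?thesis
    proof cases
      case 1
      then show ?thesis using yx[OF 1] by (simp add: sl_solution_def)
    next
      case 2
      then show ?thesis using y_Suc[of N] yx[of N] by (simp add: sl_solution_def ypoly_Suc)
    next
      case 3
      then show ?thesis using * by (simp add: sl_solution_def)
    qed
  qed
  then show "\<exists>c d. y = sl_solution N \<omega> z c d" by blast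
next
  assume "\<exists>c d. y = sl_solution N \<omega> z c d"
  then obtain c d where y: "y = sl_solution N \<omega> z c d" by blast
  have "sl_equation_holds N \<omega> z y"
    unfolding sl_equation_holds_def
  proof
    fix n assume n: "n \<in> {1..N}"
    then obtain k where k: "n = Suc k" by (cases n) auto
    show "- \<nabla> (\<lambda>k. of_real (coeff_f \<omega> k) * \<Delta> y k) n + of_real (coeff_q \<omega> n) * y n =
        z * of_real (coeff_w \<omega> n) * y n"
      using n unfolding y bwd_diff_def k
      by (simp add: quasi_diff_sl_solution sl_solution_def xpoly_Suc algebra_simps)
  qed
  then show "(\<forall>n>N + 1. y n = 0) \<and> sl_equation_holds N \<omega> z y"
    by (auto simp: y sl_solution_def)
qed

lemma solution_space_eq:
  "solution_space N (\<omega>, bc_class M) z =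
    {sl_solution N \<omega> z c d | c d. \<forall>i. poly (bc_poly N \<omega> M c d i) z = 0}"
proof -
  have bc: "bc_holds N \<omega> M (sl_solution N \<omega> z c d) \<longleftrightarrow> (\<forall>i. poly (bc_poly N \<omega> M c d i) z = 0)" for c d
    unfolding bc_holds_iff
    by (simp add: quasi_diff_sl_solution bc_poly_def) (simp add: sl_solution_def algebra_simps)
  have space: "solution_space N (\<omega>, bc_class M) z =
      {y. ((\<forall>n>N + 1. y n = 0) \<and> sl_equation_holds N \<omega> z y) \<and> bc_holds N \<omega> M y}"
    unfolding solution_space_def fst_conv snd_conv bc_holds_bc_class by blast
  show ?thesis
    unfolding space sl_equation_holds_iff using bc by (intro Collect_cong) metis
qed

lemma poly_bc_poly:
  "poly (bc_poly N \<omega> M c d i) z =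
    poly (bc_poly N \<omega> M 1 0 i) z * c + poly (bc_poly N \<omega> M 0 1 i) z * d"
  by (subst bc_poly_linear) (simp add: mult.commute)

lemma is_eigenvalue_iff_root:
  "is_eigenvalue N (\<omega>, bc_class M) z \<longleftrightarrow> poly (sl_charpoly N \<omega> M) z = 0"
proof -
  define a11 a12 a21 a22 where "a11 = poly (bc_poly N \<omega> M 1 0 1) z" and "a12 = poly (bc_poly N \<omega> M 0 1 1) z"
    and "a21 = poly (bc_poly N \<omega> M 1 0 2) z" and "a22 = poly (bc_poly N \<omega> M 0 1 2) z"
  have a: "poly (bc_poly N \<omega> M c d 1) z = a11 * c + a12 * d"
    "poly (bc_poly N \<omega> M c d 2) z = a21 * c + a22 * d" for c d
    unfolding a11_def a12_def a21_def a22_def by (rule poly_bc_poly)+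
  have "is_eigenvalue N (\<omega>, bc_class M) z \<longleftrightarrow>
      (\<exists>c d. sl_solution N \<omega> z c d \<noteq> 0 \<and> (\<forall>i. poly (bc_poly N \<omega> M c d i) z = 0))"
    unfolding is_eigenvalue_def solution_space_eq by blast
  also have "\<dots> \<longleftrightarrow> (\<exists>c d. (c \<noteq> 0 \<or> d \<noteq> 0) \<and> a11 * c + a12 * d = 0 \<and> a21 * c + a22 * d = 0)"
    by (simp only: sl_solution_eq_0_iff de_Morgan_conj forall_2 a)
  also have "\<dots> \<longleftrightarrow> a11 * a22 - a12 * a21 = 0"
  proof
    assume "\<exists>c d. (c \<noteq> 0 \<or> d \<noteq> 0) \<and> a11 * c + a12 * d = 0 \<and> a21 * c + a22 * d = 0"
    then obtain c d where cd: "c \<noteq> 0 \<or> d \<noteq> 0" "a11 * c + a12 * d = 0" "a21 * c + a22 * d = 0"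
      by blast
    from cd(2,3) have "c * (a11 * a22 - a12 * a21) = 0" "d * (a11 * a22 - a12 * a21) = 0"
      by algebra+
    with cd(1) show "a11 * a22 - a12 * a21 = 0" by auto
  next
    assume "a11 * a22 - a12 * a21 = 0"
    \<comment> \<open>A right null vector is obtained as a left null vector of the
      transpose.\<close>
    then have "a11 * a22 - a21 * a12 = 0" by (simp add: mult.commute)
    then show "\<exists>c d. (c \<noteq> 0 \<or> d \<noteq> 0) \<and> a11 * c + a12 * d = 0 \<and> a21 * c + a22 * d = 0"
      by (rule singular_2x2_left_null) (auto simp: mult.commute)
  qed
  also have "\<dots> \<longleftrightarrow> poly (sl_charpoly N \<omega> M) z = 0"
    by (simp add: sl_charpoly_def a11_def a12_def a21_def a22_def)
  finally show ?thesis .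
qed

text \<open>A + B \<Phi>(z) has rank 2, 1 or 0; its kernel, and with it the solution space, has
  dimension 0, 1 or 2. The determinant lemmas give the same numbers as orders.\<close>

lemma multiplicity_ev_eq_order:
  assumes N: "N \<ge> 2" and M: "rank M = 2" "self_adjoint_bc M"
  shows "multiplicity_ev N (\<omega>, bc_class M) z = order z (sl_charpoly N \<omega> M)"
proof -
  define a11 a12 a21 a22 where "a11 = poly (bc_poly N \<omega> M 1 0 1) z" and "a12 = poly (bc_poly N \<omega> M 0 1 1) z"
    and "a21 = poly (bc_poly N \<omega> M 1 0 2) z" and "a22 = poly (bc_poly N \<omega> M 0 1 2) z"
  have a: "poly (bc_poly N \<omega> M c d 1) z = a11 * c + a12 * d"
    "poly (bc_poly N \<omega> M c d 2) z = a21 * c + a22 * d" for c d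
    unfolding a11_def a12_def a21_def a22_def by (rule poly_bc_poly)+
  let ?s = "sl_solution N \<omega> z"
  let ?V = "solution_space N (\<omega>, bc_class M) z"
  have V: "?V = {?s c d | c d. a11 * c + a12 * d = 0 \<and> a21 * c + a22 * d = 0}"
    by (simp only: solution_space_eq forall_2 a)
  consider "poly (sl_charpoly N \<omega> M) z \<noteq> 0"
    | "poly (sl_charpoly N \<omega> M) z = 0" "a11 \<noteq> 0 \<or> a12 \<noteq> 0 \<or> a21 \<noteq> 0 \<or> a22 \<noteq> 0"
    | "a11 = 0" "a12 = 0" "a21 = 0" "a22 = 0"
    by blast
  then show ?thesis
  proof cases
    case 1
    then have "\<not> is_eigenvalue N (\<omega>, bc_class M) z" by (simp add: is_eigenvalue_iff_root)
    moreover have "?s 0 0 \<in> ?V" unfolding V by (auto intro!: exI[of _ 0])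
    ultimately have "?V = {0}" unfolding is_eigenvalue_def by auto
    then have "multiplicity_ev N (\<omega>, bc_class M) z = 0"
      unfolding multiplicity_ev_def
      by (intro cseq.dim_unique[of "{}"]) (auto simp: cseq.independent_empty)
    then show ?thesis using 1 by (simp add: order_0I)
  next
    case 2
    then obtain c d where cd: "c \<noteq> 0 \<or> d \<noteq> 0" "?s c d \<in> ?V"
      using is_eigenvalue_iff_root[of M z] sl_solution_eq_0_iff
      unfolding is_eigenvalue_def V by blast
    then obtain c' d' where "?s c d = ?s c' d'" and cd': "a11 * c' + a12 * d' = 0" "a21 * c' + a22 * d' = 0"
      unfolding V by blast
    then have "?s c' d' \<noteq> 0"
      using cd(1) sl_solution_eq_0_iff by metis
    then have nz: "c' \<noteq> 0 \<or> d' \<noteq> 0" using sl_solution_eq_0_iff by blast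
    have "?V \<subseteq> cseq.span {?s c' d'}"
    proof
      fix y assume "y \<in> ?V"
      then obtain u v where y: "y = ?s u v" and uv: "a11 * u + a12 * v = 0" "a21 * u + a22 * v = 0"
        unfolding V by blast
      \<comment> \<open>Two vectors annihilated by a common nonzero row are parallel; their
        determinant times any entry of the matrix is zero.\<close>
      have "a11 * (u * d' - v * c') = 0" "a12 * (u * d' - v * c') = 0"
        "a21 * (u * d' - v * c') = 0" "a22 * (u * d' - v * c') = 0"
        using uv cd' by algebra+
      then have "u * d' = v * c'" using 2(2) by auto
      then obtain k where "u = k * c'" "v = k * d'"
        using nz by (metis nonzero_eq_divide_eq times_divide_eq_left mult.commute)
      then have "y = seq_scale k (?s c' d')" by (simp add: y sl_solution_scale)
      then show "y \<in> cseq.span {?s c' d'}" by (simp add: cseq.span_scale cseq.span_base)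
    qed
    moreover have "?s c' d' \<in> ?V" unfolding V using cd' by blast
    ultimately have "multiplicity_ev N (\<omega>, bc_class M) z = 1"
      unfolding multiplicity_ev_def using \<open>?s c' d' \<noteq> 0\<close>
      by (intro cseq.dim_unique[of "{?s c' d'}"]) auto
    moreover have "order z (sl_charpoly N \<omega> M) = 1"
      using 2 unfolding a11_def a12_def a21_def a22_def
      by (intro order_sl_charpoly_rank_1[OF \<omega> N M]) auto
    ultimately show ?thesis by simp
  next
    case 3
    have "?s 1 0 \<notin> cseq.span {?s 0 1}"
    proof
      assume "?s 1 0 \<in> cseq.span {?s 0 1}"
      then obtain k where "?s 1 0 = seq_scale k (?s 0 1)"
        by (auto simp: cseq.span_singleton)
      then have "?s 1 (-k) = 0"
        by (subst sl_solution_linear) (simp add: seq_scale_def fun_eq_iff)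
      then show False using sl_solution_eq_0_iff by simp
    qed
    moreover from this have "?s 1 0 \<noteq> ?s 0 1" by (metis cseq.span_base singletonI)
    moreover have "?s 0 1 \<noteq> 0" using sl_solution_eq_0_iff by simp
    moreover have "?V \<subseteq> cseq.span {?s 1 0, ?s 0 1}"
    proof
      fix y assume "y \<in> ?V"
      then obtain u v where "y = ?s u v" unfolding V by blast
      then show "y \<in> cseq.span {?s 1 0, ?s 0 1}"
        using sl_solution_linear[of N \<omega> z u v]
        by (simp add: cseq.span_add cseq.span_scale cseq.span_base)
    qed
    moreover have "{?s 1 0, ?s 0 1} \<subseteq> ?V" unfolding V using 3 by auto
    ultimately have "multiplicity_ev N (\<omega>, bc_class M) z = 2"
      unfolding multiplicity_ev_def
      by (intro cseq.dim_unique[of "{?s 1 0, ?s 0 1}"]) (auto simp: cseq.independent_insert)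
    moreover have "order z (sl_charpoly N \<omega> M) = 2"
      using 3 unfolding a11_def a12_def a21_def a22_def
      by (intro order_sl_charpoly_rank_0[OF \<omega> N M])
    ultimately show ?thesis by simp
  qed
qed

lemma eigenvalue_mset_eq_proots:
  assumes N: "N \<ge> 2" and M: "rank M = 2" "self_adjoint_bc M"
  shows "eigenvalue_mset N (\<omega>, bc_class M) = proots (sl_charpoly N \<omega> M)"
proof (rule multiset_eqI)
  fix x
  have nz: "sl_charpoly N \<omega> M \<noteq> 0" by (rule sl_charpoly_nonzero[OF \<omega> N M])
  then have fin: "finite {z. poly (sl_charpoly N \<omega> M) z = 0}" by (rule poly_roots_finite)
  have "count (eigenvalue_mset N (\<omega>, bc_class M)) x =
      (\<Sum>z | poly (sl_charpoly N \<omega> M) z = 0. if x = z then order z (sl_charpoly N \<omega> M) else 0)"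
    unfolding eigenvalue_mset_def is_eigenvalue_iff_root multiplicity_ev_eq_order[OF N M] count_sum
    by (intro sum.cong) auto
  also have "\<dots> = order x (sl_charpoly N \<omega> M)"
    using fin nz by (auto simp: order_root)
  finally show "count (eigenvalue_mset N (\<omega>, bc_class M)) x = count (proots (sl_charpoly N \<omega> M)) x"
    using nz by simp
qed

end

section \<open>Continuity of the roots of real-rooted polynomials\<close>

text \<open>\<open>Re\<close> makes this total; it is a faithful list of the roots when all of them
  are real.\<close>

definition sorted_roots :: "complex poly \<Rightarrow> real list"
  where "sorted_roots P = sorted_list_of_multiset (image_mset Re (proots P))"

lemma length_sorted_roots: "length (sorted_roots P) = degree P"
  unfolding sorted_roots_def
  by (metis mset_sorted_list_of_multiset size_image_mset size_mset size_proots_complex)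

lemma sorted_sorted_roots: "sorted (sorted_roots P)"
  by (simp add: sorted_roots_def)

lemma poly_linear_factor_prod:
  "poly (\<Prod>z\<in>#A. [:- f z, 1:]) x = (\<Prod>z\<in>#A. x - f z)" for x :: "'a::comm_ring_1"
  by (induction A) (auto simp: algebra_simps)

lemma poly_sorted_roots:
  assumes real: "\<And>z. poly P z = 0 \<Longrightarrow> z \<in> \<real>" and "P \<noteq> 0"
  shows "poly P x = lead_coeff P * (\<Prod>i<degree P. x - of_real (sorted_roots P ! i))"
proof -
  have "image_mset (\<lambda>z. complex_of_real (Re z)) (proots P) = image_mset id (proots P)"
    using assms by (intro image_mset_cong) (auto simp: complex_is_Real_iff complex_eq_iff)
  then have "proots P = image_mset complex_of_real (mset (sorted_roots P))"
    by (simp add: sorted_roots_def image_mset.compositionality o_def)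
  then have "P = smult (lead_coeff P) (\<Prod>z\<in>#mset (sorted_roots P). [:- complex_of_real z, 1:])"
    using complex_poly_decompose_multiset[of P] by (simp add: image_mset.compositionality o_def)
  from arg_cong[OF this, of "\<lambda>P. poly P x"]
  have "poly P x = lead_coeff P * (\<Prod>z\<in>#mset (sorted_roots P). x - of_real z)"
    by (simp only: poly_smult poly_linear_factor_prod)
  also have "(\<Prod>z\<in>#mset (sorted_roots P). x - of_real z) = (\<Prod>i<degree P. x - of_real (sorted_roots P ! i))"
    by (simp add: prod_mset_prod_list prod.list_conv_set_nth length_sorted_roots lessThan_atLeast0
        flip: mset_map)
  finally show ?thesis .
qed

text \<open>A form of Cauchy's bound: for \<open>norm x > 1\<close> the top power equals minus the
  lower terms, each of which is at most its coefficient times \<open>norm x ^ (K - 1)\<close>;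
  cancel that power.\<close>

lemma norm_poly_root_le:
  fixes p :: "'a::{real_normed_field} poly"
  assumes p: "p \<noteq> 0" and x: "poly p x = 0"
  shows "norm x \<le> 1 + (\<Sum>k<degree p. norm (coeff p k / lead_coeff p))"
proof (cases "norm x \<le> 1")
  case True
  then show ?thesis by (smt (verit) norm_ge_zero sum_nonneg)
next
  case False
  define K where "K = degree p"
  define c where "c k = coeff p k / lead_coeff p" for k
  have "K > 0"
    using p x unfolding K_def by (metis degree_eq_zeroE gr0I pCons_0_0 poly_const_conv)
  have "0 = poly p x / lead_coeff p" using x by simp
  also have "\<dots> = (\<Sum>k\<le>K. c k * x ^ k)"
    by (simp add: poly_altdef K_def c_def sum_divide_distrib)
  also have "\<dots> = (\<Sum>k<K. c k * x ^ k) + x ^ K"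
    using p by (simp add: c_def K_def lessThan_Suc_atMost[symmetric])
  finally have "x ^ K = - (\<Sum>k<K. c k * x ^ k)"
    by (simp add: eq_neg_iff_add_eq_0 add.commute)
  then have "norm x ^ K = norm (\<Sum>k<K. c k * x ^ k)"
    by (metis norm_minus_cancel norm_power)
  also have "\<dots> \<le> (\<Sum>k<K. norm (c k) * norm x ^ (K - 1))"
    using False by (intro sum_norm_le) (auto simp: norm_mult norm_power intro!: mult_left_mono power_increasing)
  also have "\<dots> = (\<Sum>k<K. norm (c k)) * norm x ^ (K - 1)"
    by (simp add: sum_distrib_right)
  finally have "norm x * norm x ^ (K - 1) \<le> (\<Sum>k<K. norm (c k)) * norm x ^ (K - 1)"
    using \<open>K > 0\<close> by (metis power_eq_if neq0_conv)
  moreover have "norm x ^ (K - 1) > 0" using False by (intro zero_less_power) linarith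
  ultimately have "norm x \<le> (\<Sum>k<K. norm (c k))" by simp
  then show ?thesis by (simp add: c_def K_def)
qed

text \<open>A factorization into linear factors fixes the multiset of roots, and weakly increasing
  order then fixes the list. It identifies the limits of sorted roots below.\<close>

lemma sorted_roots_eqI:
  fixes L :: "nat \<Rightarrow> real"
  assumes eq: "\<And>x. poly Q x = a * (\<Prod>i<K. x - of_real (L i))" and "a \<noteq> 0"
    and mono: "\<And>i j. i \<le> j \<Longrightarrow> j < K \<Longrightarrow> L i \<le> L j"
  shows "sorted_roots Q = map L [0..<K]"
proof -
  have "Q = smult a (\<Prod>i<K. [:- complex_of_real (L i), 1:])"
    by (intro poly_eq_poly_eq_iff[THEN iffD1] ext) (simp add: eq poly_prod)
  then have "proots Q = (\<Sum>i<K. {#complex_of_real (L i)#})"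
    using \<open>a \<noteq> 0\<close> by (simp add: proots_prod)
  also have "\<dots> = mset (map (\<lambda>i. complex_of_real (L i)) [0..<K])"
    by (induction K) auto
  finally have "image_mset Re (proots Q) = mset (map L [0..<K])"
    by (simp add: image_mset.compositionality o_def)
  then have "sorted_roots Q = sort (map L [0..<K])"
    by (simp only: sorted_roots_def sorted_list_of_multiset_mset)
  also have "\<dots> = map L [0..<K]"
    using mono by (intro sorted_sort_id) (simp add: sorted_iff_nth_mono)
  finally show ?thesis .
qed

text \<open>Otherwise some sequence of polynomials tends to \<open>Q\<close> coefficientwise while
  its \<open>n\<close>-th root stays away from that of \<open>Q\<close>. The roots are bounded, a
  subsequence of them converges, and the limits are the sorted roots of \<open>Q\<close>.\<close>

lemma sorted_roots_continuous:
  assumes Q: "Q \<noteq> 0" and n: "n < degree Q" and \<epsilon>: "\<epsilon> > 0"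
  obtains \<delta> where "\<delta> > 0"
    "\<And>P. \<lbrakk>degree P = degree Q; \<And>z. poly P z = 0 \<Longrightarrow> z \<in> \<real>;
       \<And>k. k \<le> degree Q \<Longrightarrow> norm (coeff P k - coeff Q k) < \<delta>\<rbrakk> \<Longrightarrow>
      \<bar>sorted_roots P ! n - sorted_roots Q ! n\<bar> < \<epsilon>"
proof (rule ccontr)
  assume "\<not> thesis"
  define K where "K = degree Q"
  have "\<exists>P. degree P = K \<and> (\<forall>z. poly P z = 0 \<longrightarrow> z \<in> \<real>) \<and>
      (\<forall>k\<le>K. norm (coeff P k - coeff Q k) < inverse (real (Suc j))) \<and>
      \<not> \<bar>sorted_roots P ! n - sorted_roots Q ! n\<bar> < \<epsilon>" for j
    using that[of "inverse (real (Suc j))"] \<open>\<not> thesis\<close> unfolding K_def by fastforce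
  then obtain P where deg: "\<And>j. degree (P j) = K"
    and real: "\<And>j z. poly (P j) z = 0 \<Longrightarrow> z \<in> \<real>"
    and close: "\<And>j k. k \<le> K \<Longrightarrow> norm (coeff (P j) k - coeff Q k) < inverse (real (Suc j))"
    and far: "\<And>j. \<not> \<bar>sorted_roots (P j) ! n - sorted_roots Q ! n\<bar> < \<epsilon>"
    by metis
  have P_nz: "P j \<noteq> 0" for j
    using n deg[of j] by (auto simp: K_def)
  have factored: "poly (P j) x = coeff (P j) K * (\<Prod>i<K. x - of_real (sorted_roots (P j) ! i))" for j x
    using poly_sorted_roots[of "P j" x] real P_nz[of j] deg[of j] by blast
  have coeff_lim: "(\<lambda>j. coeff (P j) k) \<longlonglongrightarrow> coeff Q k" if "k \<le> K" for k
    by (rule LIMSEQ_norm_0[THEN Lim_null[THEN iffD2]])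
      (use close[OF that] in \<open>auto simp: less_imp_le inverse_eq_divide\<close>)
  have lead_nz: "coeff Q K \<noteq> 0" "coeff (P j) K \<noteq> 0" for j
    using leading_coeff_0_iff[of Q] leading_coeff_0_iff[of "P j"] Q P_nz[of j] deg[of j]
    by (simp_all add: K_def)
  \<comment> \<open>The common degree enters here: the leading coefficients tend to
    \<open>coeff Q K \<noteq> 0\<close>, so the root bounds converge and are uniformly
    bounded.\<close>
  have "(\<lambda>j. 1 + (\<Sum>k<K. norm (coeff (P j) k / coeff (P j) K))) \<longlonglongrightarrow>
      1 + (\<Sum>k<K. norm (coeff Q k / coeff Q K))"
    using lead_nz by (intro tendsto_intros coeff_lim) auto
  then have "Bseq (\<lambda>j. 1 + (\<Sum>k<K. norm (coeff (P j) k / coeff (P j) K)))"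
    by (rule convergent_imp_Bseq[OF convergentI])
  then obtain B where B: "\<And>j. norm (1 + (\<Sum>k<K. norm (coeff (P j) k / coeff (P j) K))) \<le> B"
    by (auto simp: Bseq_def)
  have bounded: "norm (sorted_roots (P j) ! i) \<le> B" if "i \<in> {..<K}" for i j
  proof -
    have "poly (P j) (of_real (sorted_roots (P j) ! i)) = 0"
      unfolding factored mult_eq_0_iff using that by (intro disjI2 prod_zero) auto
    then have "norm (complex_of_real (sorted_roots (P j) ! i)) \<le>
        1 + (\<Sum>k<K. norm (coeff (P j) k / coeff (P j) K))"
      using norm_poly_root_le[OF P_nz] unfolding deg by blast
    then show ?thesis using B[of j] by (simp add: norm_of_real)
  qed
  \<comment> \<open>One subsequence serves all \<open>K\<close> root positions at once.\<close>
  obtain r where r: "strict_mono (r :: nat \<Rightarrow> nat)"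
    and "\<And>i. i \<in> {..<K} \<Longrightarrow> \<exists>l. (\<lambda>j. sorted_roots (P (r j)) ! i) \<longlonglongrightarrow> l"
    using function_convergent_subsequence[of "{..<K}" "\<lambda>j i. sorted_roots (P j) ! i" B] bounded
    by auto
  then obtain L where L: "\<And>i. i < K \<Longrightarrow> (\<lambda>j. sorted_roots (P (r j)) ! i) \<longlonglongrightarrow> L i"
    by (metis lessThan_iff)
  have coeff_lim': "(\<lambda>j. coeff (P (r j)) k) \<longlonglongrightarrow> coeff Q k" if "k \<le> K" for k
    using LIMSEQ_subseq_LIMSEQ[OF coeff_lim[OF that] r] by (simp add: o_def)
  \<comment> \<open>Both sides are limits of the same values, computed once from the coefficients
    and once from the factorization.\<close>
  have "poly Q x = coeff Q K * (\<Prod>i<K. x - of_real (L i))" for x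
  proof (rule LIMSEQ_unique)
    have "(\<lambda>j. \<Sum>k\<le>K. coeff (P (r j)) k * x ^ k) \<longlonglongrightarrow> (\<Sum>k\<le>K. coeff Q k * x ^ k)"
      by (intro tendsto_intros coeff_lim') auto
    then show "(\<lambda>j. poly (P (r j)) x) \<longlonglongrightarrow> poly Q x"
      by (simp add: poly_altdef deg flip: K_def)
    have "(\<lambda>j. coeff (P (r j)) K * (\<Prod>i<K. x - of_real (sorted_roots (P (r j)) ! i)))
        \<longlonglongrightarrow> coeff Q K * (\<Prod>i<K. x - of_real (L i))"
      by (intro tendsto_intros coeff_lim' L) auto
    then show "(\<lambda>j. poly (P (r j)) x) \<longlonglongrightarrow> coeff Q K * (\<Prod>i<K. x - of_real (L i))"
      by (simp add: factored)
  qed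
  moreover have "L i \<le> L j" if "i \<le> j" "j < K" for i j
  proof (rule LIMSEQ_le)
    show "\<exists>N. \<forall>m\<ge>N. sorted_roots (P (r m)) ! i \<le> sorted_roots (P (r m)) ! j"
      using that sorted_nth_mono[OF sorted_sorted_roots] by (simp add: length_sorted_roots deg)
  qed (use that L in auto)
  ultimately have "sorted_roots Q = map L [0..<K]"
    using lead_nz(1) by (intro sorted_roots_eqI) auto
  then have "sorted_roots Q ! n = L n" using n by (simp add: K_def)
  then have "\<forall>\<^sub>F j in sequentially. dist (sorted_roots (P (r j)) ! n) (sorted_roots Q ! n) < \<epsilon>"
    using L[of n] n \<epsilon> unfolding K_def tendsto_iff by simp
  then show False
    using far by (auto simp: dist_real_def dest: eventually_happens')
qed

section \<open>Continuity of the eigenvalues\<close>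

text \<open>A row relation s of \<open>T ** M\<close> is the relation sT of \<open>M\<close>;
  multiplying by the inverse of \<open>T\<close> recovers s.\<close>

lemma rank_invertible_mult:
  fixes M :: "'a::field^'n^2" and T :: "'a^2^2"
  assumes T: "invertible T" and M: "rank M = 2"
  shows "rank (T ** M) = 2"
  unfolding rank_eq_2_iff
proof (intro allI impI)
  fix s1 s2
  assume s: "\<forall>j. s1 * (T ** M) $ 1 $ j + s2 * (T ** M) $ 2 $ j = 0"
  obtain T' where T': "T ** T' = mat 1" using T by (auto simp: invertible_def)
  define u where "u k = s1 * T $ 1 $ k + s2 * T $ 2 $ k" for k
  have "u 1 * M $ 1 $ j + u 2 * M $ 2 $ j = 0" for j
    using s[rule_format, of j] by (simp add: matrix_matrix_mult_def sum_2 u_def algebra_simps)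
  then have u: "u 1 = 0 \<and> u 2 = 0" using M unfolding rank_eq_2_iff by blast
  have "u 1 * T' $ 1 $ j + u 2 * T' $ 2 $ j = s1 * (T ** T') $ 1 $ j + s2 * (T ** T') $ 2 $ j" for j
    by (simp add: matrix_matrix_mult_def sum_2 u_def algebra_simps)
  from this[of 1] this[of 2] show "s1 = 0 \<and> s2 = 0"
    unfolding T' using u by (simp add: mat_def)
qed

text \<open>Both sides of the defining equation turn from X into
  \<open>T X T\<^sup>*\<close>.\<close>

lemma self_adjoint_bc_mult:
  assumes "self_adjoint_bc M"
  shows "self_adjoint_bc (T ** M)"
proof -
  have blocks: "left_block (T ** M) = T ** left_block M" "right_block (T ** M) = T ** right_block M"
    by (simp_all add: vec_eq_iff forall_2 left_block_def right_block_def matrix_matrix_mult_def)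
  have adj: "adjoint_mat (T ** A) = adjoint_mat A ** adjoint_mat T" for A :: "complex^2^2"
    by (simp add: vec_eq_iff adjoint_mat_def matrix_matrix_mult_def mult.commute)
  have "T ** (A ** J_mat ** adjoint_mat A) ** adjoint_mat T =
      T ** A ** J_mat ** adjoint_mat (T ** A)" for A
    by (simp add: adj matrix_mul_assoc)
  then show ?thesis
    using assms unfolding self_adjoint_bc_def blocks by metis
qed

lemma bc_class_mult:
  assumes "invertible T"
  shows "bc_class (T ** M) = bc_class M"
proof
  show "bc_class (T ** M) \<subseteq> bc_class M"
    using assms invertible_mult unfolding bc_class_def by (auto simp: matrix_mul_assoc)
  obtain T' where T': "T' ** T = mat 1" "T ** T' = mat 1" using assms by (auto simp: invertible_def)
  show "bc_class M \<subseteq> bc_class (T ** M)"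
  proof
    fix M' assume "M' \<in> bc_class M"
    then obtain R where R: "M' = R ** M" "invertible R" by (auto simp: bc_class_def)
    then have "M' = (R ** T') ** (T ** M)"
      by (metis T'(1) matrix_mul_assoc matrix_mul_lid)
    moreover have "invertible (R ** T')"
      using R(2) T' by (intro invertible_mult) (auto simp: invertible_def)
    ultimately show "M' \<in> bc_class (T ** M)" by (auto simp: bc_class_def)
  qed
qed

text \<open>The saturation of \<open>W\<close> is the union of its preimages under left
  multiplication by invertible matrices, each of which is open. Neighbourhoods of a representative
  thus yield neighbourhoods of its class.\<close>

lemma openin_BC_top_image:
  assumes "open W"
  shows "openin BC_top (bc_class ` (W \<inter> rank2_matrices) \<inter> BC)"
proof -
  have "{M \<in> rank2_matrices. bc_class M \<in> bc_class ` (W \<inter> rank2_matrices)} =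
      rank2_matrices \<inter> (\<Union>T\<in>Collect invertible. (\<lambda>M. T ** M) -` W)"
  proof (intro set_eqI iffI)
    fix M assume M: "M \<in> {M \<in> rank2_matrices. bc_class M \<in> bc_class ` (W \<inter> rank2_matrices)}"
    then obtain M' where M': "M' \<in> W" "bc_class M = bc_class M'" by blast
    then have "M' \<in> bc_class M" using bc_class_self by blast
    then obtain T where "M' = T ** M" "invertible T" unfolding bc_class_def by blast
    with M M' show "M \<in> rank2_matrices \<inter> (\<Union>T\<in>Collect invertible. (\<lambda>M. T ** M) -` W)"
      by blast
  next
    fix M assume "M \<in> rank2_matrices \<inter> (\<Union>T\<in>Collect invertible. (\<lambda>M. T ** M) -` W)"
    then obtain T where T: "M \<in> rank2_matrices" "invertible T" "T ** M \<in> W" by blast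
    then have "T ** M \<in> W \<inter> rank2_matrices"
      using rank_invertible_mult by (auto simp: rank2_matrices_def)
    then have "bc_class (T ** M) \<in> bc_class ` (W \<inter> rank2_matrices)" by blast
    with T show "M \<in> {M \<in> rank2_matrices. bc_class M \<in> bc_class ` (W \<inter> rank2_matrices)}"
      by (simp add: bc_class_mult)
  qed
  moreover have "open ((\<lambda>M. T ** M) -` W)" for T :: "complex^2^2"
    using assms unfolding matrix_matrix_mult_def
    by (intro open_vimage continuous_intros)
  ultimately have "openin (top_of_set rank2_matrices)
      {M \<in> rank2_matrices. bc_class M \<in> bc_class ` (W \<inter> rank2_matrices)}"
    by (auto simp: openin_open intro!: exI[of _ "\<Union>T\<in>Collect invertible. (\<lambda>M. T ** M) -` W"])
  then have "openin (quotient_topology (top_of_set rank2_matrices) bc_class)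
      (bc_class ` (W \<inter> rank2_matrices))"
    by (auto simp: openin_quotient_topology)
  then show ?thesis
    unfolding BC_top_def openin_subtopology by blast
qed

section \<open>Continuous dependence of the characteristic polynomial\<close>

lemma tendsto_coeff_mult:
  fixes P Q :: "'b \<Rightarrow> complex poly"
  assumes "\<And>k. ((\<lambda>x. coeff (P x) k) \<longlongrightarrow> coeff p k) F" "\<And>k. ((\<lambda>x. coeff (Q x) k) \<longlongrightarrow> coeff q k) F"
  shows "((\<lambda>x. coeff (P x * Q x) k) \<longlongrightarrow> coeff (p * q) k) F"
  unfolding coeff_mult by (intro tendsto_intros assms)

lemma tendsto_coeff_linear:
  fixes a b :: "'b \<Rightarrow> complex"
  assumes "(a \<longlongrightarrow> a') F" "(b \<longlongrightarrow> b') F"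
  shows "((\<lambda>x. coeff [:a x, b x:] k) \<longlongrightarrow> coeff [:a', b':] k) F"
  using assms by (simp add: coeff_pCons split: nat.split)

context
  fixes N :: nat and x0 :: "sl_equation \<times> (complex^4^2)"
  assumes x0: "fst x0 \<in> Omega N"
begin

text \<open>Limits run over pairs of an equation and an arbitrary matrix, since
  \<open>sl_charpoly\<close> depends on the representing matrix and not on its class alone.\<close>

abbreviation "rep_filter \<equiv> atin (prod_topology (Omega_top N) euclidean) x0"

lemma tendsto_rep_filter:
  assumes "continuous_map (prod_topology (Omega_top N) euclidean) euclidean g"
  shows "(g \<longlongrightarrow> g x0) rep_filter"
proof -
  have "x0 \<in> topspace (prod_topology (Omega_top N) euclidean)"
    using x0 by (cases x0) (auto simp: Omega_top_def Omega_def PiE_def Pi_def)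
  from assms[unfolded continuous_map_atin, rule_format, OF this] show ?thesis by simp
qed

lemma tendsto_coefficients:
  shows "k \<in> {0..N} \<Longrightarrow> ((\<lambda>x. fst (fst x) k) \<longlongrightarrow> fst (fst x0) k) rep_filter"
    and "k \<in> {1..N} \<Longrightarrow> ((\<lambda>x. coeff_q (fst x) k) \<longlongrightarrow> coeff_q (fst x0) k) rep_filter"
    and "k \<in> {1..N} \<Longrightarrow> ((\<lambda>x. coeff_w (fst x) k) \<longlongrightarrow> coeff_w (fst x0) k) rep_filter"
    and "((\<lambda>x. snd x $ i $ j) \<longlongrightarrow> snd x0 $ i $ j) rep_filter"
proof -
  let ?X = "prod_topology (Omega_top N) (euclidean :: (complex^4^2) topology)"
  let ?P = "prod_topology (powertop_real {0..N}) (prod_topology (powertop_real {1..N}) (powertop_real {1..N}))"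
  have \<omega>: "continuous_map ?X ?P fst"
    unfolding Omega_top_def using continuous_map_fst continuous_map_into_fulltopology by blast
  note comp = continuous_map_compose[OF \<omega>, unfolded o_def]
  note fst' = continuous_map_compose[OF comp[OF continuous_map_fst], unfolded o_def]
  note snd' = continuous_map_compose[OF comp[OF continuous_map_snd], unfolded o_def]
  note fst_snd' = continuous_map_compose[OF snd'[OF continuous_map_fst], unfolded o_def]
  note snd_snd' = continuous_map_compose[OF snd'[OF continuous_map_snd], unfolded o_def]
  show "k \<in> {0..N} \<Longrightarrow> ((\<lambda>x. fst (fst x) k) \<longlongrightarrow> fst (fst x0) k) rep_filter"
    by (intro tendsto_rep_filter fst'[OF continuous_map_product_projection])
  show "k \<in> {1..N} \<Longrightarrow> ((\<lambda>x. coeff_q (fst x) k) \<longlongrightarrow> coeff_q (fst x0) k) rep_filter"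
    unfolding coeff_q_def by (intro tendsto_rep_filter fst_snd'[OF continuous_map_product_projection])
  show "k \<in> {1..N} \<Longrightarrow> ((\<lambda>x. coeff_w (fst x) k) \<longlongrightarrow> coeff_w (fst x0) k) rep_filter"
    unfolding coeff_w_def by (intro tendsto_rep_filter snd_snd'[OF continuous_map_product_projection])
  have "(snd \<longlongrightarrow> snd x0) rep_filter"
    by (intro tendsto_rep_filter continuous_map_snd)
  then show "((\<lambda>x. snd x $ i $ j) \<longlongrightarrow> snd x0 $ i $ j) rep_filter"
    by (intro tendsto_vec_nth)
qed

text \<open>Convergence is coefficientwise, so degrees may drop in the limit.
  \<open>n \<le> N\<close> keeps the indices of 1/f, q and w met by the recursion within their
  ranges.\<close>

lemma tendsto_coeff_ivp:
  "n \<le> N \<Longrightarrow>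
    (\<forall>k. ((\<lambda>x. coeff (ypoly (fst x) c d n) k) \<longlongrightarrow> coeff (ypoly (fst x0) c d n) k) rep_filter) \<and>
    (\<forall>k. ((\<lambda>x. coeff (xpoly (fst x) c d n) k) \<longlongrightarrow> coeff (xpoly (fst x0) c d n) k) rep_filter)"
proof (induction n)
  case (Suc n)
  then have IH: "((\<lambda>x. coeff (ypoly (fst x) c d n) k) \<longlongrightarrow> coeff (ypoly (fst x0) c d n) k) rep_filter"
    "((\<lambda>x. coeff (xpoly (fst x) c d n) k) \<longlongrightarrow> coeff (xpoly (fst x0) c d n) k) rep_filter" for k
    by auto
  have y: "((\<lambda>x. coeff (ypoly (fst x) c d (Suc n)) k) \<longlongrightarrow>
      coeff (ypoly (fst x0) c d (Suc n)) k) rep_filter" for k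
    unfolding ypoly_Suc coeff_add coeff_smult
    using Suc.prems by (intro tendsto_intros IH tendsto_coefficients) auto
  moreover have "((\<lambda>x. coeff (xpoly (fst x) c d (Suc n)) k) \<longlongrightarrow>
      coeff (xpoly (fst x0) c d (Suc n)) k) rep_filter" for k
    unfolding xpoly_Suc coeff_add
    using Suc.prems
    by (intro tendsto_add IH y tendsto_coeff_mult tendsto_coeff_linear tendsto_minus tendsto_of_real
        tendsto_coefficients) auto
  ultimately show ?case by blast
qed simp

lemma tendsto_coeff_bc_poly:
  "((\<lambda>x. coeff (bc_poly N (fst x) (snd x) c d i) k) \<longlongrightarrow>
    coeff (bc_poly N (fst x0) (snd x0) c d i) k) rep_filter"
proof -
  have "((\<lambda>x. snd x $ i $ 1 * c + snd x $ i $ 2 * d) \<longlongrightarrow>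
      snd x0 $ i $ 1 * c + snd x0 $ i $ 2 * d) rep_filter"
    by (intro tendsto_intros tendsto_coefficients)
  then have "((\<lambda>x. coeff [:snd x $ i $ 1 * c + snd x $ i $ 2 * d:] k) \<longlongrightarrow>
      coeff [:snd x0 $ i $ 1 * c + snd x0 $ i $ 2 * d:] k) rep_filter"
    by (simp add: coeff_pCons split: nat.split)
  moreover have "((\<lambda>x. coeff (ypoly (fst x) c d N) k) \<longlongrightarrow> coeff (ypoly (fst x0) c d N) k) rep_filter"
    "((\<lambda>x. coeff (xpoly (fst x) c d N) k) \<longlongrightarrow> coeff (xpoly (fst x0) c d N) k) rep_filter"
    using tendsto_coeff_ivp[of N] by blast+
  ultimately show ?thesis
    unfolding bc_poly_def coeff_add coeff_smult
    by (intro tendsto_add tendsto_mult tendsto_coefficients)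
qed

lemma tendsto_coeff_sl_charpoly:
  "((\<lambda>x. coeff (sl_charpoly N (fst x) (snd x)) k) \<longlongrightarrow>
    coeff (sl_charpoly N (fst x0) (snd x0)) k) rep_filter"
  unfolding sl_charpoly_def coeff_diff
  by (intro tendsto_diff tendsto_coeff_mult tendsto_coeff_bc_poly)

end

section \<open>From roots of polynomials to eigenvalue functions\<close>

lemma SLP_cases:
  assumes "p \<in> SLP N"
  obtains \<omega> M where "p = (\<omega>, bc_class M)" "\<omega> \<in> Omega N" "rank M = 2" "self_adjoint_bc M"
  using assms by (auto simp: SLP_def BC_def rank2_matrices_def)

context
  fixes N \<omega> M
  assumes asm: "\<omega> \<in> Omega N" "N \<ge> 2" "rank M = 2" "self_adjoint_bc M"
begin

lemma num_eigenvalues_eq_degree: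
  "num_eigenvalues N (\<omega>, bc_class M) = degree (sl_charpoly N \<omega> M)"
  using eigenvalue_mset_eq_proots[OF asm] by (simp add: num_eigenvalues_def size_proots_complex)

lemma nth_eigenvalue_eq_sorted_roots:
  "nth_eigenvalue N n (\<omega>, bc_class M) = sorted_roots (sl_charpoly N \<omega> M) ! n"
  using eigenvalue_mset_eq_proots[OF asm] by (simp add: nth_eigenvalue_def sorted_roots_def)

lemma is_eigenvalue_nth_eigenvalue_rep:
  assumes "nth_eigenvalue_defined N n (\<omega>, bc_class M)"
  shows "is_eigenvalue N (\<omega>, bc_class M) (of_real (nth_eigenvalue N n (\<omega>, bc_class M)))"
proof -
  have "n < degree (sl_charpoly N \<omega> M)"
    using assms by (simp add: nth_eigenvalue_defined_def num_eigenvalues_eq_degree)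
  then show ?thesis
    unfolding is_eigenvalue_iff_root[OF asm(1)] nth_eigenvalue_eq_sorted_roots
    using poly_sorted_roots[OF sl_charpoly_root_real[OF asm] sl_charpoly_nonzero[OF asm]]
    by auto
qed

end

lemma is_eigenvalue_nth_eigenvalue:
  assumes "N \<ge> 2" "p \<in> SLP N" "nth_eigenvalue_defined N n p"
  shows "is_eigenvalue N p (of_real (nth_eigenvalue N n p))"
  using assms is_eigenvalue_nth_eigenvalue_rep by (metis SLP_cases)

text \<open>A constant number of eigenvalues is a constant degree of the characteristic polynomial,
  so continuity of sorted roots applies near a representative and is carried to classes by openness
  of \<open>bc_class\<close>.\<close>

lemma continuous_map_nth_eigenvalue:
  assumes N: "N \<ge> 2" and S: "S \<subseteq> SLP N"
    and num: "\<And>p. p \<in> S \<Longrightarrow> num_eigenvalues N p = K" and n: "n < K"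
  shows "continuous_map (subtopology (SLP_top N) S) euclideanreal (nth_eigenvalue N n)"
  unfolding continuous_map_atin limitin_canonical_iff
proof (intro ballI tendstoI)
  fix p and \<epsilon> :: real
  assume "p \<in> topspace (subtopology (SLP_top N) S)" and \<epsilon>: "\<epsilon> > 0"
  then have p: "p \<in> S" by simp
  then have "p \<in> SLP N" using S by blast
  then obtain \<omega> M where \<omega>M: "p = (\<omega>, bc_class M)" "\<omega> \<in> Omega N" "rank M = 2" "self_adjoint_bc M"
    by (rule SLP_cases)
  note rep = \<omega>M(2) N \<omega>M(3,4)
  let ?Q = "sl_charpoly N \<omega> M"
  let ?X = "prod_topology (Omega_top N) (euclidean :: (complex^4^2) topology)"
  have deg: "degree ?Q = K"
    using num[OF p] num_eigenvalues_eq_degree[OF rep] \<omega>M(1) by simp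
  obtain \<delta> where \<delta>: "\<delta> > 0" and close:
    "\<And>P. \<lbrakk>degree P = degree ?Q; \<And>z. poly P z = 0 \<Longrightarrow> z \<in> \<real>;
       \<And>k. k \<le> degree ?Q \<Longrightarrow> norm (coeff P k - coeff ?Q k) < \<delta>\<rbrakk> \<Longrightarrow>
      \<bar>sorted_roots P ! n - sorted_roots ?Q ! n\<bar> < \<epsilon>"
    using sorted_roots_continuous[of ?Q n \<epsilon>] sl_charpoly_nonzero[OF rep] n \<epsilon> deg by blast
  let ?near = "\<lambda>x. \<forall>k\<in>{..K}. norm (coeff (sl_charpoly N (fst x) (snd x)) k - coeff ?Q k) < \<delta>"
  have "\<forall>\<^sub>F x in atin ?X (\<omega>, M). ?near x"
    using tendstoD[OF tendsto_coeff_sl_charpoly[of "(\<omega>, M)" N] \<delta>] \<omega>M(2)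
    by (intro eventually_ball_finite) (auto simp: dist_norm)
  moreover have in_X: "(\<omega>, M) \<in> topspace ?X"
    using \<omega>M(2) by (auto simp: Omega_top_def Omega_def PiE_def Pi_def)
  ultimately obtain U where U: "openin ?X U" "(\<omega>, M) \<in> U" and "\<And>x. x \<in> U - {(\<omega>, M)} \<Longrightarrow> ?near x"
    unfolding eventually_atin by blast
  \<comment> \<open>\<open>atin\<close> leaves out the point itself, where the differences are
    zero.\<close>
  then have near: "?near x" if "x \<in> U" for x
    using that \<delta> by (cases "x = (\<omega>, M)") auto
  obtain U1 W where U1: "openin (Omega_top N) U1" "\<omega> \<in> U1" and W: "open W" "M \<in> W"
    and sub: "U1 \<times> W \<subseteq> U"
    using U unfolding openin_prod_topology_alt by (metis open_openin)
  \<comment> \<open>Each problem in \<open>V\<close> has a representative in \<open>W\<close>, which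
    together with its equation lies in \<open>U\<close>.\<close>
  define V where "V = U1 \<times> (bc_class ` (W \<inter> rank2_matrices) \<inter> BC)"
  have "openin (SLP_top N) V"
    unfolding V_def SLP_top_def openin_prod_Times_iff
    using U1(1) openin_BC_top_image[OF W(1)] by blast
  moreover have "p \<in> V"
    using U1 W \<omega>M by (auto simp: V_def BC_def rank2_matrices_def)
  moreover have "dist (nth_eigenvalue N n p') (nth_eigenvalue N n p) < \<epsilon>" if p': "p' \<in> V \<inter> S" for p'
  proof -
    obtain \<omega>' M' where M': "p' = (\<omega>', bc_class M')" "\<omega>' \<in> U1" "M' \<in> W" "rank M' = 2"
      using p' by (auto simp: V_def rank2_matrices_def)
    have "p' \<in> SLP N" using p' S by blast
    \<comment> \<open>The representative found in \<open>W\<close> has rank 2; its self-adjointness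
      is inherited from a self-adjoint member of the same class.\<close>
    then obtain M2 where "bc_class M' = bc_class M2" "self_adjoint_bc M2" and \<omega>': "\<omega>' \<in> Omega N"
      using M'(1) by (auto elim!: SLP_cases)
    then have "self_adjoint_bc M'"
      using bc_class_self[of M'] self_adjoint_bc_mult by (auto simp: bc_class_def)
    note rep' = \<omega>' N M'(4) this
    have "(\<omega>', M') \<in> U" using M' sub by blast
    from near[OF this] have "\<bar>sorted_roots (sl_charpoly N \<omega>' M') ! n - sorted_roots ?Q ! n\<bar> < \<epsilon>"
      using num[of p'] p' num_eigenvalues_eq_degree[OF rep'] M'(1) sl_charpoly_root_real[OF rep']
      by (intro close) (auto simp: deg)
    then show ?thesis
      by (simp add: \<omega>M(1) M'(1) nth_eigenvalue_eq_sorted_roots[OF rep]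
          nth_eigenvalue_eq_sorted_roots[OF rep'] dist_real_def)
  qed
  ultimately show "\<forall>\<^sub>F p' in atin (subtopology (SLP_top N) S) p.
      dist (nth_eigenvalue N n p') (nth_eigenvalue N n p) < \<epsilon>"
    unfolding eventually_atin using p by (intro disjI2 exI[of _ "V \<inter> S"]) (auto simp: openin_subtopology)
qed

text \<open>The second part assumes equal numbers of eigenvalues, so that each
  \<open>nth_eigenvalue\<close> considered there is meaningful on all of \<open>S\<close>.\<close>

theorem theorem2p1:
  fixes N :: nat and S :: "slp set"
  assumes "N \<ge> 2" and "S \<subseteq> SLP N"
  shows "((\<forall>p\<in>S. \<forall>p'\<in>S. num_eigenvalues N p = num_eigenvalues N p') \<longleftrightarrow>
      (\<forall>n. eigenvalue_function_on N n S \<longrightarrow> nth_eigenvalue_continuous_on N n S)) \<and>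
    (connectedin (SLP_top N) S \<longrightarrow>
      (\<forall>p\<in>S. \<forall>p'\<in>S. num_eigenvalues N p = num_eigenvalues N p') \<longrightarrow>
      (\<forall>n. eigenvalue_function_on N n S \<longrightarrow>
        (\<forall>p\<in>S. nth_eigenvalue_defined N n p) \<and>
        locally_continuous_eigenvalue_branch N S (nth_eigenvalue N n)))"
proof -
  have continuous: "nth_eigenvalue_continuous_on N n S"
    if same: "\<forall>p\<in>S. \<forall>p'\<in>S. num_eigenvalues N p = num_eigenvalues N p'"
      and eigenvalue: "eigenvalue_function_on N n S" for n
  proof -
    obtain p where p: "p \<in> S" "n < num_eigenvalues N p"
      using eigenvalue by (auto simp: eigenvalue_function_on_def nth_eigenvalue_defined_def)
    then have num: "num_eigenvalues N p' = num_eigenvalues N p" if "p' \<in> S" for p'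
      using same that by blast
    have "n < num_eigenvalues N p'" if "p' \<in> S" for p'
      using p(2) num[OF that] by simp
    then show ?thesis
      using continuous_map_nth_eigenvalue[OF assms num p(2)]
      unfolding nth_eigenvalue_continuous_on_def nth_eigenvalue_defined_def by blast
  qed
  have same: "num_eigenvalues N p = num_eigenvalues N p'"
    if *: "\<forall>n. eigenvalue_function_on N n S \<longrightarrow> nth_eigenvalue_continuous_on N n S"
      and "p \<in> S" "p' \<in> S" for p p'
  proof -
    \<comment> \<open>A function defined at one of the two points is defined at the other, and a
      natural number is determined by the numbers below it.\<close>
    have "n < num_eigenvalues N p' \<longleftrightarrow> n < num_eigenvalues N p" for n
      using * \<open>p \<in> S\<close> \<open>p' \<in> S\<close>
      unfolding eigenvalue_function_on_def nth_eigenvalue_continuous_on_def nth_eigenvalue_defined_def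
      by blast
    then show ?thesis by (metis linorder_less_linear less_irrefl)
  qed
  have branch: "locally_continuous_eigenvalue_branch N S (nth_eigenvalue N n)"
    if "connectedin (SLP_top N) S" "nth_eigenvalue_continuous_on N n S" for n
  proof -
    \<comment> \<open>Being connected and open in itself, \<open>S\<close> serves as both the open
      set and the neighbourhood of every point.\<close>
    have "continuous_eigenvalue_branch N S (nth_eigenvalue N n)"
      using that is_eigenvalue_nth_eigenvalue[OF assms(1)] assms(2)
      unfolding continuous_eigenvalue_branch_def nth_eigenvalue_continuous_on_def by blast
    moreover have "topspace (subtopology (SLP_top N) S) = S"
      using assms(2) by (auto simp: topspace_SLP_top)
    then have "openin (subtopology (SLP_top N) S) S"
      by (metis openin_topspace)
    ultimately show ?thesis
      unfolding locally_continuous_eigenvalue_branch_def by blast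
  qed
  have defined: "nth_eigenvalue_defined N n p" if "nth_eigenvalue_continuous_on N n S" "p \<in> S" for n p
    using that by (simp add: nth_eigenvalue_continuous_on_def)
  show ?thesis
    using continuous same branch defined by blast
qed

end
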